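(* Let $\{X_\gamma\}_{\gamma>0}$ be $\mathbb{R}^d$-valued random variables and $\mathcal{E}\subset\mathbb{R}^d$ such that Assumptions (A) and (B) of the context hold, and consider the problem of estimating $p=p(\gamma)=P(\frac1\gamma X_\gamma\in\mathcal{E})$. Suppose that $A$ is a dominating set for $\mathcal{E}$ of finite cardinality with $k$ most significant dominating points $a_1,\dots,a_k$, i.e. $I(a_1)=\cdots=I(a_k)<I(a')$ for all $a'\in A\setminus\{a_1,\dots,a_k\}$. Let $\alpha_1,\dots,\alpha_k>0$ with $\sum_{i=1}^k\alpha_i=1$, and let $\tilde P$ be the mixture of exponential tiltings $$\frac{d\tilde P}{dP}=\sum_{i=1}^k\alpha_i e^{s_{a_i}^\top X_\gamma-\gamma\mu_\gamma(s_{a_i})}.$$ Then the importance sampling estimator $Z=\mathbf 1\{\frac1\gamma X_\gamma\in\mathcal{E}\}\frac{dP}{d\tilde P}$ under $\tilde P$ is strongly probabilistically efficient.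
   Context: Setting. $\mu_\gamma(x)=\frac1\gamma\log E(e^{x^\top X_\gamma})$, $x\in\mathbb{R}^d$; $\mathcal{D}(f)=\{x:f(x)<\infty\}$; $S^\circ$, $\overline S$, $\partial S$ denote interior, closure, boundary. Assumption (A): (1) $\mu(x)=\lim_{\gamma\to\infty}\mu_\gamma(x)$ exists for every $x\in\mathbb{R}^d$, where $\infty$ is allowed both as a limit value and as an element of the sequence; (2) $0\in\mathcal{D}(\mu)^\circ$; (3) $\mu$ is essentially smooth: $\mathcal{D}(\mu)^\circ\neq\emptyset$, $\mu$ is differentiable on $\mathcal{D}(\mu)^\circ$, and $\mu$ is steep ($\|\nabla\mu(x_n)\|\to\infty$ whenever $x_n\in\mathcal{D}(\mu)^\circ$ converges to a boundary point of $\mathcal{D}(\mu)^\circ$). Rate function: $I(y)=\sup_{x\in\mathbb{R}^d}\{x^\top y-\mu(x)\}$; for a set $S$, $I(S)=\inf_{y\in S}I(y)$. Assumption (B): $\mathcal{E}\subset\mathbb{R}^d$ is a Borel set with $\overline{\mathcal{E}}=\overline{\mathcal{E}^\circ}$, $\mathcal{E}^\circ\cap\mathcal{D}(I)^\circ\neq\emptyset$ and $I(\mathcal{E})>0$. Dominating set: $A=\{a_1,\dots,a_r\}\subset\partial\mathcal{E}$ is a dominating set for $\mathcal{E}$ if (1) for each $i$, $a_i\in\mathcal{D}(I)^\circ$ and there is a unique $s_{a_i}\in\mathbb{R}^d$ with $\nabla\mu(s_{a_i})=a_i$; (2) $\mathcal{E}\subset\bigcup_{i=1}^r\{x:s_{a_i}^\top(x-a_i)\ge0\}$;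 (3) for every $i$, $A\setminus\{a_i\}$ does not satisfy (2). Points of $A$ are dominating points; $a$ is more significant than $a'$ if $I(a)<I(a')$. Tiltings are well defined whenever the corresponding $\mu_\gamma(s_{a_i})$ is finite, which holds for all large $\gamma$. Efficiency. For an estimator $\hat p$ of $p$ generated under $\tilde P$ and $\varepsilon>0$, let $\delta_\varepsilon(\hat p,p)=\inf\{\delta>0:\tilde P(|\hat p-p|>\delta p)\le\varepsilon\}$. Let $\hat p$ be the sample mean of $n=n(\gamma)$ independent replications of $Z$. $Z$ is strongly probabilistically efficient if one can choose $n$ subexponential in $-\log p$ (i.e. $\log n/(-\log p)\to0$ as $\gamma\to\infty$) such that for every $\varepsilon>0$, $\lim_{\gamma\to\infty}\delta_\varepsilon(\hat p,p)=0$. *)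

theory Defs
  imports "HOL-Probability.Probability"
begin

section \<open>Limiting cumulant generating function\<close>

text \<open>The logarithm on \<open>[0, \<infinity>]\<close>, with \<open>log 0 = -\<infinity>\<close> and \<open>log \<infinity> = \<infinity>\<close>.\<close>

definition elog :: "ennreal \<Rightarrow> ereal" where
  "elog m = (if m = 0 then -\<infinity> else if m = \<infinity> then \<infinity> else ereal (ln (enn2real m)))"

text \<open>The expectation is a nonnegative Lebesgue integral, so that an infinite exponential moment
  makes the value \<open>\<infinity>\<close> (a Bochner integral would be \<open>0\<close> there).\<close>

definition scaled_cgf ::
  "'w measure \<Rightarrow> (real \<Rightarrow> 'w \<Rightarrow> 'a::euclidean_space) \<Rightarrow> real \<Rightarrow> 'a \<Rightarrow> ereal" where
  "scaled_cgf M X \<gamma> x = elog (\<integral>\<^sup>+ \<omega>. ennreal (exp (x \<bullet> X \<gamma> \<omega>)) \<partial>M) / ereal \<gamma>"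

definition eff_dom :: "('a \<Rightarrow> ereal) \<Rightarrow> 'a set" where
  "eff_dom f = {x. f x < \<infinity>}"

text \<open>An extended real function has a gradient only at interior points of its effective domain;
  without this restriction, \<^const>\<open>real_of_ereal\<close> would produce the spurious gradient \<open>0\<close> at
  interior points of the set where \<open>f = \<infinity>\<close>.\<close>

definition has_gradient :: "('a::euclidean_space \<Rightarrow> ereal) \<Rightarrow> 'a \<Rightarrow> 'a \<Rightarrow> bool" where
  "has_gradient f x g \<longleftrightarrow>
     x \<in> interior (eff_dom f) \<and> GDERIV (\<lambda>z. real_of_ereal (f z)) x :> g"

definition steep :: "('a::euclidean_space \<Rightarrow> ereal) \<Rightarrow> bool" where
  "steep f \<longleftrightarrow>
     (\<forall>x g z. (\<forall>n. x n \<in> interior (eff_dom f) \<and> has_gradient f (x n) (g n)) \<and>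
        x \<longlonglongrightarrow> z \<and> z \<in> frontier (interior (eff_dom f))
        \<longrightarrow> filterlim (\<lambda>n. norm (g n)) at_top sequentially)"

definition essentially_smooth :: "('a::euclidean_space \<Rightarrow> ereal) \<Rightarrow> bool" where
  "essentially_smooth f \<longleftrightarrow>
     interior (eff_dom f) \<noteq> {} \<and>
     (\<lambda>z. real_of_ereal (f z)) differentiable_on interior (eff_dom f) \<and>
     steep f"

text \<open>A limit \<open>-\<infinity>\<close> need not be excluded separately: \<open>\<mu>\<close> is convex with \<open>\<mu> 0 = 0\<close>, and \<open>\<mu> < \<infinity>\<close>
  near \<open>0\<close>, so \<open>\<mu> x = -\<infinity>\<close> would force \<open>\<mu> 0 = -\<infinity>\<close>. In particular \<open>\<mu>\<close> is finite on
  \<^term>\<open>eff_dom \<mu>\<close>.\<close>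

definition assumption_A ::
  "'w measure \<Rightarrow> (real \<Rightarrow> 'w \<Rightarrow> 'a::euclidean_space) \<Rightarrow> ('a \<Rightarrow> ereal) \<Rightarrow> bool" where
  "assumption_A M X \<mu> \<longleftrightarrow>
     (\<forall>x. ((\<lambda>\<gamma>. scaled_cgf M X \<gamma> x) \<longlongrightarrow> \<mu> x) at_top) \<and>
     0 \<in> interior (eff_dom \<mu>) \<and>
     essentially_smooth \<mu>"

section \<open>Rate function and dominating sets\<close>

definition rate :: "('a::euclidean_space \<Rightarrow> ereal) \<Rightarrow> 'a \<Rightarrow> ereal" where
  "rate \<mu> y = (SUP x. ereal (x \<bullet> y) - \<mu> x)"

definition rate_set :: "('a::euclidean_space \<Rightarrow> ereal) \<Rightarrow> 'a set \<Rightarrow> ereal" where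
  "rate_set \<mu> S = (INF y\<in>S. rate \<mu> y)"

definition assumption_B :: "('a::euclidean_space \<Rightarrow> ereal) \<Rightarrow> 'a set \<Rightarrow> bool" where
  "assumption_B \<mu> E \<longleftrightarrow>
     E \<in> sets borel \<and>
     closure E = closure (interior E) \<and>
     interior E \<inter> interior (eff_dom (rate \<mu>)) \<noteq> {} \<and>
     rate_set \<mu> E > 0"

text \<open>The point \<open>s\<^sub>a\<close> with \<open>\<nabla>\<mu>(s\<^sub>a) = a\<close>; meaningful where it is unique, as
  demanded for all points of a dominating set.\<close>

definition tilt_param :: "('a::euclidean_space \<Rightarrow> ereal) \<Rightarrow> 'a \<Rightarrow> 'a" where
  "tilt_param \<mu> a = (THE s. has_gradient \<mu> s a)"

definition halfspaces_cover :: "('a::euclidean_space \<Rightarrow> ereal) \<Rightarrow> 'a set \<Rightarrow> 'a set \<Rightarrow> bool" where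
  "halfspaces_cover \<mu> E A \<longleftrightarrow> E \<subseteq> (\<Union>a\<in>A. {x. tilt_param \<mu> a \<bullet> (x - a) \<ge> 0})"

definition dominating_set :: "('a::euclidean_space \<Rightarrow> ereal) \<Rightarrow> 'a set \<Rightarrow> 'a set \<Rightarrow> bool" where
  "dominating_set \<mu> E A \<longleftrightarrow>
     finite A \<and> A \<subseteq> frontier E \<and>
     (\<forall>a\<in>A. a \<in> interior (eff_dom (rate \<mu>)) \<and> (\<exists>!s. has_gradient \<mu> s a)) \<and>
     halfspaces_cover \<mu> E A \<and>
     (\<forall>a\<in>A. \<not> halfspaces_cover \<mu> E (A - {a}))"

section \<open>Importance sampling\<close>

text \<open>In the tilted measure, \<^const>\<open>real_of_ereal\<close> is harmless: \<open>\<mu>\<^sub>\<gamma>(s)\<close> is finite for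
  all large \<open>\<gamma>\<close>, and only the limit \<open>\<gamma> \<rightarrow> \<infinity>\<close> is considered. For other \<open>\<gamma>\<close> the measure
  below need not be a probability measure.\<close>

definition tilted_mixture ::
  "'w measure \<Rightarrow> (real \<Rightarrow> 'w \<Rightarrow> 'a::euclidean_space) \<Rightarrow> nat \<Rightarrow> (nat \<Rightarrow> real) \<Rightarrow> (nat \<Rightarrow> 'a)
     \<Rightarrow> real \<Rightarrow> 'w measure" where
  "tilted_mixture M X k \<alpha> s \<gamma> =
     density M (\<lambda>\<omega>. ennreal (\<Sum>i=1..k.
       \<alpha> i * exp (s i \<bullet> X \<gamma> \<omega> - \<gamma> * real_of_ereal (scaled_cgf M X \<gamma> (s i)))))"

definition target_prob ::
  "'w measure \<Rightarrow> (real \<Rightarrow> 'w \<Rightarrow> 'a::euclidean_space) \<Rightarrow> 'a set \<Rightarrow> real \<Rightarrow> real" where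
  "target_prob M X E \<gamma> = measure M {\<omega> \<in> space M. (1 / \<gamma>) *\<^sub>R X \<gamma> \<omega> \<in> E}"

text \<open>\<^term>\<open>RN_deriv Q M\<close> is the density of \<open>M\<close> with respect to \<open>Q\<close>.\<close>

definition is_estimator ::
  "'w measure \<Rightarrow> 'w measure \<Rightarrow> (real \<Rightarrow> 'w \<Rightarrow> 'a::euclidean_space) \<Rightarrow> 'a set
     \<Rightarrow> real \<Rightarrow> 'w \<Rightarrow> real" where
  "is_estimator M Q X E \<gamma> \<omega> =
     indicator E ((1 / \<gamma>) *\<^sub>R X \<gamma> \<omega>) * enn2real (RN_deriv Q M \<omega>)"

definition sample_mean :: "('w \<Rightarrow> real) \<Rightarrow> nat \<Rightarrow> (nat \<Rightarrow> 'w) \<Rightarrow> real" where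
  "sample_mean Z n w = (\<Sum>j<n. Z (w j)) / real n"

text \<open>Accuracy \<open>\<delta>\<^sub>\<epsilon>\<close> of the sample mean of \<open>n\<close> independent replications of \<open>Z\<close> under \<open>Q\<close>, taken
  on the \<open>n\<close>-fold product of \<open>Q\<close>. The infimum is in \<^typ>\<open>ereal\<close>, so that it is \<open>\<infinity>\<close> for
  the empty set.\<close>

definition accuracy ::
  "'w measure \<Rightarrow> ('w \<Rightarrow> real) \<Rightarrow> nat \<Rightarrow> real \<Rightarrow> real \<Rightarrow> ereal" where
  "accuracy Q Z n p \<epsilon> =
     (INF \<delta>\<in>{\<delta>. \<delta> > 0 \<and>
        emeasure (PiM {..<n} (\<lambda>_. Q))
          {w \<in> space (PiM {..<n} (\<lambda>_. Q)). \<bar>sample_mean Z n w - p\<bar> > \<delta> * p} \<le> ennreal \<epsilon>}.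
      ereal \<delta>)"

text \<open>The quotient \<open>log n / (- log p)\<close> is formed in \<^typ>\<open>ereal\<close>, so that it is \<open>\<infinity>\<close> rather than
  \<open>0\<close> when \<open>p = 1\<close> and \<open>n > 1\<close>.\<close>

definition strongly_prob_efficient ::
  "(real \<Rightarrow> 'w measure) \<Rightarrow> (real \<Rightarrow> 'w \<Rightarrow> real) \<Rightarrow> (real \<Rightarrow> real) \<Rightarrow> bool" where
  "strongly_prob_efficient Q Z p \<longleftrightarrow>
     (\<exists>n :: real \<Rightarrow> nat.
        (\<forall>\<gamma>. n \<gamma> \<ge> 1) \<and>
        ((\<lambda>\<gamma>. ereal (ln (real (n \<gamma>))) / - elog (ennreal (p \<gamma>))) \<longlongrightarrow> 0) at_top \<and>
        (\<forall>\<epsilon>>0. ((\<lambda>\<gamma>. accuracy (Q \<gamma>) (Z \<gamma>) (n \<gamma>) (p \<gamma>) \<epsilon>) \<longlongrightarrow> 0) at_top))"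

end

theory Submission
  imports Defs
begin

text \<open>
Write \<open>\<kappa> \<gamma>\<close> for the scaled cumulant generating function, \<open>I\<close> for the rate function and \<open>I0\<close> for its
common value at the most significant dominating points. The estimator is split as \<open>Z = Z1 + Z2\<close>,
where \<open>Z1\<close> lives on the part \<open>E1\<close> of the target set that is covered by the half-spaces of
\<open>a 1, \<dots>, a k\<close>, and \<open>Z2\<close> on the remainder \<open>E2\<close>.

On \<open>E1\<close> one of the terms of the likelihood ratio is at least
\<open>\<alpha> i * exp (\<gamma> * (s i \<bullet> a i - \<kappa> \<gamma> (s i)))\<close>, so \<open>Z1 \<le> C \<gamma>\<close> with \<open>C \<gamma> = exp (- \<gamma> * (I0 + o(1)))\<close>. Hence
the second moment of \<open>Z1\<close> is at most \<open>C \<gamma> * p\<close>, and Chebyshev's inequality makes the relative error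
of its sample mean small in probability as soon as \<open>n\<close> is large compared with \<open>C \<gamma> / p\<close>. This \<open>n\<close> is
subexponential once \<open>p\<close> is known to be at least \<open>exp (- \<gamma> * (I0 + o(1)))\<close>.

On \<open>E2\<close> the estimator may have infinite variance, but it has mean \<open>P(X / \<gamma> \<in> E2)\<close>. Since \<open>E2\<close> is
covered by the half-spaces of the less significant points, Chernoff's bound shows that this mean is
exponentially small compared with \<open>p\<close>, and Markov's inequality suffices. It is here that one uses
convergence in probability instead of a bound on the variance. The two parts are put together in
\<open>emeasure_sample_mean_error\<close> and \<open>strongly_prob_efficientI\<close>.

The remaining ingredient is the lower bound for \<open>p\<close>, \<open>ld_lower_bound\<close>. A most significant dominating
point is a limit of interior points \<open>y\<close> of \<open>E\<close> at which \<open>I\<close> is almost \<open>I0\<close>, as \<open>I\<close> is convex and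
hence continuous on the interior of its domain. For such \<open>y\<close> there is \<open>s\<close> with \<open>\<nabla>\<mu>(s) = y\<close>; this is
\<open>gradient_surjective\<close>, the only place where steepness of \<open>\<mu>\<close> enters. Under the measure tilted by \<open>s\<close>
the variable \<open>X / \<gamma>\<close> concentrates at \<open>y\<close>, because differentiability of \<open>\<mu>\<close> at \<open>s\<close> gives an
exponential bound in each coordinate direction (\<open>tilt_concentrates\<close>), and undoing the tilting costs
the factor \<open>exp (- \<gamma> * (I y + o(1)))\<close> (\<open>ld_lower_bound_ball\<close>).
\<close>

section \<open>Deviations of sample means\<close>

text \<open>Centred independent copies are orthogonal: a product of two coordinates is a product over all
  coordinates, with constant factors \<open>1\<close>, and its integral factorises.\<close>

lemma
  fixes Y :: "'w \<Rightarrow> real"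
  assumes Q: "prob_space Q" and Y: "Y \<in> borel_measurable Q"
    and bdd: "\<And>x. \<bar>Y x\<bar> \<le> B" and mean0: "(\<integral>x. Y x \<partial>Q) = 0"
  shows integrable_iid_sum_square:
      "integrable (PiM {..<n} (\<lambda>_. Q)) (\<lambda>w. (\<Sum>j<n. Y (w j))\<^sup>2)" (is ?int)
    and integral_iid_sum_square:
      "(\<integral>w. (\<Sum>j<n. Y (w j))\<^sup>2 \<partial>PiM {..<n} (\<lambda>_. Q)) = real n * (\<integral>x. (Y x)\<^sup>2 \<partial>Q)" (is ?eq)
proof -
  interpret Q: prob_space Q by fact
  interpret P: product_prob_space "\<lambda>_. Q" "{..<n}" by unfold_locales
  let ?P = "PiM {..<n} (\<lambda>_. Q)"
  define f where "f i j l = (\<lambda>x. (if l = i then Y x else 1) * (if l = j then Y x else 1))" for i j l :: nat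
  have intY: "integrable Q Y"
    by (rule Q.integrable_const_bound[of _ B]) (use bdd Y in auto)
  have "\<bar>Y x * Y x\<bar> \<le> B * B" for x
    using mult_mono[OF bdd[of x] bdd[of x]] bdd[of x] by (auto simp: abs_mult)
  then have intYY: "integrable Q (\<lambda>x. Y x * Y x)"
    by (intro Q.integrable_const_bound[of _ "B * B"]) (use Y in auto)
  have intf: "integrable Q (f i j l)" for i j l
  proof -
    have "f i j l = (if l = i \<and> l = j then (\<lambda>x. Y x * Y x) else if l = i \<or> l = j then Y else (\<lambda>x. 1))"
      by (auto simp: f_def fun_eq_iff)
    then show ?thesis using intY intYY by auto
  qed
  have prod: "Y (w i) * Y (w j) = (\<Prod>l<n. f i j l (w l))" if "i < n" "j < n" for i j w
  proof -
    have "(\<Prod>l<n. if l = i then Y (w l) else 1) = Y (w i)"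
      "(\<Prod>l<n. if l = j then Y (w l) else 1) = Y (w j)"
      using that by (auto simp: prod.delta)
    then show ?thesis unfolding f_def prod.distrib by simp
  qed
  have int2: "integrable ?P (\<lambda>w. Y (w i) * Y (w j))" if "i < n" "j < n" for i j
    unfolding prod[OF that] by (intro P.product_integrable_prod intf) auto
  have val2: "(\<integral>w. Y (w i) * Y (w j) \<partial>?P) = (if i = j then \<integral>x. (Y x)\<^sup>2 \<partial>Q else 0)"
    if "i < n" "j < n" for i j
  proof -
    have "(\<integral>w. Y (w i) * Y (w j) \<partial>?P) = (\<Prod>l<n. \<integral>x. f i j l x \<partial>Q)"
      unfolding prod[OF that] by (intro P.product_integral_prod intf) auto
    also have "\<dots> = (if i = j then \<integral>x. (Y x)\<^sup>2 \<partial>Q else 0)"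
    proof (cases "i = j")
      case True
      then have "(\<Prod>l<n. \<integral>x. f i j l x \<partial>Q) = (\<Prod>l<n. if l = i then \<integral>x. (Y x)\<^sup>2 \<partial>Q else 1)"
        by (intro prod.cong) (auto simp: f_def power2_eq_square Q.prob_space)
      then show ?thesis using that True by simp
    next
      case False
      then have "(\<integral>x. f i j i x \<partial>Q) = 0" using mean0 by (simp add: f_def)
      then show ?thesis using False that by (intro trans[OF prod_zero]) auto
    qed
    finally show ?thesis .
  qed
  have sq: "(\<Sum>j<n. Y (w j))\<^sup>2 = (\<Sum>i<n. \<Sum>j<n. Y (w i) * Y (w j))" for w
    by (simp add: power2_eq_square sum_product)
  show ?int unfolding sq using int2 by (intro Bochner_Integration.integrable_sum) auto
  have "(\<integral>w. (\<Sum>j<n. Y (w j))\<^sup>2 \<partial>?P) = (\<Sum>i<n. \<Sum>j<n. if i = j then \<integral>x. (Y x)\<^sup>2 \<partial>Q else 0)"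
    unfolding sq using int2 val2
    by (subst Bochner_Integration.integral_sum, force)
       (intro sum.cong refl, subst Bochner_Integration.integral_sum, auto)
  then show ?eq by simp
qed

text \<open>Chebyshev's inequality in a form that does not lose the mean: for values in \<open>[0, C]\<close> the
  second moment is at most \<open>C\<close> times the mean, which for a rare event is far smaller than \<open>C\<^sup>2\<close>.\<close>

lemma sample_mean_deviation_bounded:
  fixes Z :: "'w \<Rightarrow> real"
  assumes Q: "prob_space Q" and Z[measurable]: "Z \<in> borel_measurable Q"
    and bdd: "\<And>x. 0 \<le> Z x" "\<And>x. Z x \<le> C" and n: "n > 0" and t: "t > 0"
  shows "measure (PiM {..<n} (\<lambda>_. Q))
      {w \<in> space (PiM {..<n} (\<lambda>_. Q)). \<bar>sample_mean Z n w - (\<integral>x. Z x \<partial>Q)\<bar> \<ge> t}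
    \<le> C * (\<integral>x. Z x \<partial>Q) / (real n * t\<^sup>2)"
proof -
  interpret Q: prob_space Q by fact
  let ?P = "PiM {..<n} (\<lambda>_. Q)"
  interpret P: prob_space ?P by (intro prob_space_PiM Q)
  define m where "m = (\<integral>x. Z x \<partial>Q)"
  define Y where "Y x = Z x - m" for x
  have intZ: "integrable Q Z"
    by (rule Q.integrable_const_bound[of _ C]) (use bdd in auto)
  have Y: "Y \<in> borel_measurable Q" unfolding Y_def by simp
  have bddY: "\<bar>Y x\<bar> \<le> C + \<bar>m\<bar>" for x using bdd[of x] unfolding Y_def by linarith
  have mean0: "(\<integral>x. Y x \<partial>Q) = 0"
    using intZ by (simp add: Y_def m_def Q.prob_space)
  have eq: "sample_mean Z n w - m = (\<Sum>j<n. Y (w j)) / real n" for w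
    using n by (simp add: sample_mean_def Y_def sum_subtractf field_simps)
  have [measurable]: "(\<lambda>w. \<Sum>j<n. Y (w j)) \<in> borel_measurable ?P"
    using Y by measurable
  have "measure ?P {w \<in> space ?P. \<bar>sample_mean Z n w - m\<bar> \<ge> t}
      = measure ?P {w \<in> space ?P. \<bar>\<Sum>j<n. Y (w j)\<bar> \<ge> real n * t}"
    unfolding eq using n by (intro arg_cong[where f="measure ?P"]) (auto simp: field_simps)
  also have "\<dots> \<le> (\<integral>w. (\<Sum>j<n. Y (w j))\<^sup>2 \<partial>?P) / (real n * t)\<^sup>2"
    using n t by (intro P.second_moment_method integrable_iid_sum_square[OF Q Y bddY mean0]) auto
  also have "\<dots> = real n * (\<integral>x. (Y x)\<^sup>2 \<partial>Q) / (real n * t)\<^sup>2"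
    by (simp add: integral_iid_sum_square[OF Q Y bddY mean0])
  also have "\<dots> \<le> real n * (C * m) / (real n * t)\<^sup>2"
  proof -
    have le: "(Z x)\<^sup>2 \<le> C * Z x" for x
      using bdd[of x] by (auto simp: power2_eq_square intro: mult_right_mono)
    have int2: "integrable Q (\<lambda>x. (Z x)\<^sup>2)"
    proof (rule Bochner_Integration.integrable_bound[of Q "\<lambda>x. C * Z x"])
      show "AE x in Q. norm ((Z x)\<^sup>2) \<le> norm (C * Z x)"
        using le by (intro AE_I2) (smt (verit) real_norm_def zero_le_power2)
    qed (use intZ in auto)
    have "(\<integral>x. (Y x)\<^sup>2 \<partial>Q) = (\<integral>x. (Z x)\<^sup>2 \<partial>Q) - m\<^sup>2"
      using Q.variance_eq[OF intZ int2] by (simp add: Y_def m_def)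
    also have "\<dots> \<le> (\<integral>x. C * Z x \<partial>Q)"
      using integral_mono[OF int2 integrable_mult_right[OF intZ] le] zero_le_power2[of m]
      by linarith
    also have "\<dots> = C * m" by (simp add: m_def)
    finally show ?thesis unfolding m_def by (intro divide_right_mono mult_left_mono) auto
  qed
  also have "\<dots> = C * m / (real n * t\<^sup>2)"
    using n by (simp add: power2_eq_square field_simps)
  finally show ?thesis by (simp add: m_def)
qed

text \<open>Markov's inequality, for the part of an estimator whose second moment may be infinite but
  whose mean is negligible.\<close>

lemma sample_mean_deviation_integrable:
  fixes Z :: "'w \<Rightarrow> real"
  assumes Q: "prob_space Q" and Z: "integrable Q Z" and nonneg: "\<And>x. 0 \<le> Z x"
    and n: "n > 0" and t: "t > 0"
  shows "measure (PiM {..<n} (\<lambda>_. Q))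
      {w \<in> space (PiM {..<n} (\<lambda>_. Q)). \<bar>sample_mean Z n w - (\<integral>x. Z x \<partial>Q)\<bar> \<ge> t}
    \<le> 2 * (\<integral>x. Z x \<partial>Q) / t"
proof -
  interpret Q: prob_space Q by fact
  let ?P = "PiM {..<n} (\<lambda>_. Q)"
  interpret P: prob_space ?P by (intro prob_space_PiM Q)
  define m where "m = (\<integral>x. Z x \<partial>Q)"
  have m: "m \<ge> 0" using nonneg by (simp add: m_def)
  have comp: "integrable ?P (\<lambda>w. Z (w j))" "(\<integral>w. Z (w j) \<partial>?P) = m" if "j < n" for j
  proof -
    have d: "distr ?P Q (\<lambda>w. w j) = Q"
      using that by (intro distr_PiM_component Q) auto
    have [measurable]: "(\<lambda>w. w j) \<in> measurable ?P Q" using that by simp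
    show "integrable ?P (\<lambda>w. Z (w j))"
      by (rule integrable_distr[of _ _ Q]) (use d Z in auto)
    have "(\<integral>x. Z x \<partial>distr ?P Q (\<lambda>w. w j)) = (\<integral>w. Z (w j) \<partial>?P)"
      by (rule integral_distr) (use Z in auto)
    then show "(\<integral>w. Z (w j) \<partial>?P) = m" using d by (simp add: m_def)
  qed
  have int: "integrable ?P (\<lambda>w. sample_mean Z n w)"
    unfolding sample_mean_def using comp(1)
    by (intro integrable_divide_zero Bochner_Integration.integrable_sum) auto
  have val: "(\<integral>w. sample_mean Z n w \<partial>?P) = m"
    unfolding sample_mean_def using comp n by simp
  have sm: "sample_mean Z n w \<ge> 0" for w
    unfolding sample_mean_def by (auto intro!: divide_nonneg_nonneg sum_nonneg nonneg)
  have [measurable]: "(\<lambda>w. sample_mean Z n w) \<in> borel_measurable ?P" using int by auto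
  have "measure ?P {w \<in> space ?P. \<bar>sample_mean Z n w - m\<bar> \<ge> t}
     \<le> measure ?P {w \<in> space ?P. sample_mean Z n w + m \<ge> t}"
  proof (intro P.finite_measure_mono)
    show "{w \<in> space ?P. \<bar>sample_mean Z n w - m\<bar> \<ge> t} \<subseteq> {w \<in> space ?P. sample_mean Z n w + m \<ge> t}"
    proof clarify
      fix w assume "\<bar>sample_mean Z n w - m\<bar> \<ge> t"
      then show "sample_mean Z n w + m \<ge> t" using m sm[of w] by linarith
    qed
  qed simp
  also have "\<dots> \<le> (\<integral>w. sample_mean Z n w + m \<partial>?P) / t"
    using int t m sm by (intro integral_Markov_inequality_measure[of _ _ "{}"]) auto
  also have "\<dots> = 2 * m / t" using int val by (simp add: P.prob_space)
  finally show ?thesis by (simp add: m_def)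
qed

text \<open>Half of the admissible error \<open>\<delta> * p\<close> is spent on each part. The identity \<open>Z = Z1 + Z2\<close> is
  required almost everywhere only, because a Radon--Nikodym derivative is determined only up to null
  sets.\<close>

lemma emeasure_sample_mean_error:
  fixes Z Z1 Z2 :: "'w \<Rightarrow> real"
  assumes Q: "prob_space Q"
    and split: "AE x in Q. Z x = Z1 x + Z2 x"
    and Z1: "Z1 \<in> borel_measurable Q" "\<And>x. 0 \<le> Z1 x" "\<And>x. Z1 x \<le> C"
    and Z2: "integrable Q Z2" "\<And>x. 0 \<le> Z2 x"
    and p: "p = (\<integral>x. Z1 x \<partial>Q) + (\<integral>x. Z2 x \<partial>Q)" "p > 0"
    and n: "n > 0" and \<delta>: "\<delta> > 0"
  shows "emeasure (PiM {..<n} (\<lambda>_. Q))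
      {w \<in> space (PiM {..<n} (\<lambda>_. Q)). \<bar>sample_mean Z n w - p\<bar> > \<delta> * p}
    \<le> ennreal (4 / \<delta>\<^sup>2 * (C / (real n * p)) + 4 / \<delta> * ((\<integral>x. Z2 x \<partial>Q) / p))"
proof -
  interpret Q: prob_space Q by fact
  let ?P = "PiM {..<n} (\<lambda>_. Q)"
  interpret P: prob_space ?P by (intro prob_space_PiM Q)
  define p1 where "p1 = (\<integral>x. Z1 x \<partial>Q)"
  define p2 where "p2 = (\<integral>x. Z2 x \<partial>Q)"
  define t where "t = \<delta> * p / 2"
  have t: "t > 0" using p \<delta> by (simp add: t_def)
  have p12: "p = p1 + p2" "p1 \<ge> 0" "p2 \<ge> 0" using p Z1 Z2 by (auto simp: p1_def p2_def)
  let ?B1 = "{w \<in> space ?P. \<bar>sample_mean Z1 n w - p1\<bar> \<ge> t}"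
  let ?B2 = "{w \<in> space ?P. \<bar>sample_mean Z2 n w - p2\<bar> \<ge> t}"
  have [measurable]: "Z1 \<in> borel_measurable Q" "Z2 \<in> borel_measurable Q" using Z1 Z2 by auto
  have [measurable]: "sample_mean Z1 n \<in> borel_measurable ?P" "sample_mean Z2 n \<in> borel_measurable ?P"
    unfolding sample_mean_def by measurable
  have "AE w in ?P. \<forall>j\<in>{..<n}. Z (w j) = Z1 (w j) + Z2 (w j)"
    by (intro AE_finite_allI AE_PiM_component[of _ "\<lambda>_. Q"] Q split) auto
  then have AE: "AE w in ?P. w \<in> {w \<in> space ?P. \<bar>sample_mean Z n w - p\<bar> > \<delta> * p} \<longrightarrow> w \<in> ?B1 \<union> ?B2"
  proof (rule AE_mp, intro AE_I2 impI)
    fix w assume w: "w \<in> space ?P" "\<forall>j\<in>{..<n}. Z (w j) = Z1 (w j) + Z2 (w j)"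
      "w \<in> {w \<in> space ?P. \<bar>sample_mean Z n w - p\<bar> > \<delta> * p}"
    have "sample_mean Z n w = sample_mean Z1 n w + sample_mean Z2 n w"
      using w(2) by (simp add: sample_mean_def sum.distrib add_divide_distrib)
    then have "\<bar>sample_mean Z n w - p\<bar> \<le> \<bar>sample_mean Z1 n w - p1\<bar> + \<bar>sample_mean Z2 n w - p2\<bar>"
      using p12(1) by linarith
    moreover have "\<bar>sample_mean Z n w - p\<bar> > t + t" using w(3) by (simp add: t_def)
    ultimately have "\<not> (\<bar>sample_mean Z1 n w - p1\<bar> < t \<and> \<bar>sample_mean Z2 n w - p2\<bar> < t)"
      by linarith
    then show "w \<in> ?B1 \<union> ?B2" using w(1) by auto
  qed
  have "emeasure ?P {w \<in> space ?P. \<bar>sample_mean Z n w - p\<bar> > \<delta> * p} \<le> emeasure ?P (?B1 \<union> ?B2)"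
    by (rule emeasure_mono_AE[OF AE]) measurable
  also have "\<dots> = ennreal (measure ?P (?B1 \<union> ?B2))" by (rule P.emeasure_eq_measure)
  also have "\<dots> \<le> ennreal (C * p1 / (real n * t\<^sup>2) + 2 * p2 / t)"
  proof (rule ennreal_leI)
    have "measure ?P (?B1 \<union> ?B2) \<le> measure ?P ?B1 + measure ?P ?B2"
      by (rule measure_Un_le) measurable
    also have "\<dots> \<le> C * p1 / (real n * t\<^sup>2) + 2 * p2 / t"
      unfolding p1_def p2_def
      by (intro add_mono sample_mean_deviation_bounded sample_mean_deviation_integrable Q Z1 Z2 n t)
    finally show "measure ?P (?B1 \<union> ?B2) \<le> C * p1 / (real n * t\<^sup>2) + 2 * p2 / t" .
  qed
  also have "\<dots> \<le> ennreal (C * p / (real n * t\<^sup>2) + 2 * p2 / t)"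
  proof -
    have "C \<ge> 0" using Z1(2,3) order_trans by blast
    then show ?thesis
      using p12 t by (intro ennreal_leI add_right_mono divide_right_mono mult_left_mono) auto
  qed
  also have "C * p / (real n * t\<^sup>2) + 2 * p2 / t = 4 / \<delta>\<^sup>2 * (C / (real n * p)) + 4 / \<delta> * (p2 / p)"
    using p(2) n \<delta> unfolding t_def by (simp add: field_simps power2_eq_square)
  finally show ?thesis by (simp add: p2_def)
qed

section \<open>Convex functions with values in the extended reals\<close>

text \<open>Convexity of the strict epigraph. Comparing with real upper bounds avoids sums of the form
  \<open>\<infinity> - \<infinity>\<close> for functions that take both infinite values.\<close>

definition epi_convex :: "('a::real_vector \<Rightarrow> ereal) \<Rightarrow> bool" where
  "epi_convex f \<longleftrightarrow>
     (\<forall>x y b c t. 0 \<le> t \<longrightarrow> t \<le> 1 \<longrightarrow> f x < ereal b \<longrightarrow> f y < ereal c \<longrightarrow>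
        f (t *\<^sub>R x + (1 - t) *\<^sub>R y) \<le> ereal (t * b + (1 - t) * c))"

lemma epi_convexD:
  assumes "epi_convex f" "0 \<le> t" "t \<le> 1" "f x < ereal b" "f y < ereal c"
  shows "f (t *\<^sub>R x + (1 - t) *\<^sub>R y) \<le> ereal (t * b + (1 - t) * c)"
  using assms unfolding epi_convex_def by blast

lemma eff_domE:
  assumes "x \<in> eff_dom f"
  obtains b where "f x < ereal b"
  using assms less_PInf_Ex_of_nat[of "f x"] unfolding eff_dom_def by auto

lemma convex_eff_dom:
  assumes "epi_convex f"
  shows "convex (eff_dom f)"
  unfolding convex_alt
proof (intro ballI allI impI)
  fix x y u assume xy: "x \<in> eff_dom f" "y \<in> eff_dom f" and u: "0 \<le> u \<and> u \<le> (1::real)"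
  obtain b c where "f x < ereal b" "f y < ereal c" using xy by (auto elim!: eff_domE)
  from epi_convexD[OF assms _ _ this(2) this(1), of u] u
  have "f (u *\<^sub>R y + (1 - u) *\<^sub>R x) < \<infinity>" by (auto simp: less_top)
  then show "(1 - u) *\<^sub>R x + u *\<^sub>R y \<in> eff_dom f"
    by (simp add: eff_dom_def add.commute)
qed

text \<open>A point with value \<open>-\<infinity>\<close> would pull down to \<open>-\<infinity>\<close> all points strictly inside the segments that
  join it to points of the effective domain, and an interior point of the domain lies on such a
  segment.\<close>

lemma epi_convex_not_MInf:
  fixes f :: "'a::euclidean_space \<Rightarrow> ereal"
  assumes f: "epi_convex f" and z: "z \<in> interior (eff_dom f)" "f z \<noteq> -\<infinity>"
  shows "f x \<noteq> -\<infinity>"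
proof
  assume x: "f x = -\<infinity>"
  obtain e where e: "e > 0" "cball z e \<subseteq> eff_dom f"
    using z(1) by (meson mem_interior_cball)
  define h where "h = e / (norm (z - x) + 1)"
  have h: "h > 0" using e by (auto simp: h_def intro!: divide_pos_pos add_nonneg_pos)
  (* z lies strictly between x and the point y, reached from x by overshooting z. *)
  define y where "y = z + h *\<^sub>R (z - x)"
  have "norm (z - x) / (norm (z - x) + 1) \<le> 1"
    by (subst divide_le_eq_1_pos) (auto intro: add_nonneg_pos)
  then have "h * norm (z - x) \<le> e"
    using e mult_left_mono[of "norm (z - x) / (norm (z - x) + 1)" 1 e] by (simp add: h_def)
  then have "y \<in> eff_dom f"
    using e h by (intro subsetD[OF e(2)]) (simp add: y_def dist_norm)
  then obtain c where c: "f y < ereal c" by (elim eff_domE)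
  obtain v where v: "ereal v < f z"
    using z(2) ereal_dense2[of "-\<infinity>" "f z"] by auto
  define t where "t = h / (1 + h)"
  have t: "0 < t" "t \<le> 1" using h by (auto simp: t_def)
  have t1: "1 - t = 1 / (1 + h)" using h by (simp add: t_def field_simps)
  have "t *\<^sub>R x + (1 - t) *\<^sub>R y = (1 / (1 + h)) *\<^sub>R (h *\<^sub>R x + y)"
    unfolding t1 by (simp add: t_def scaleR_add_right)
  also have "h *\<^sub>R x + y = (1 + h) *\<^sub>R z"
    by (simp add: y_def algebra_simps)
  finally have comb: "t *\<^sub>R x + (1 - t) *\<^sub>R y = z" using h by simp
  (* The value at x may be bounded by any real number; this one makes the convex combination equal to v < f z. *)
  have "f z \<le> ereal (t * ((v - (1 - t) * c) / t) + (1 - t) * c)"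
    using epi_convexD[OF f _ t(2) _ c, of x "(v - (1 - t) * c) / t"] t x comb by simp
  also have "\<dots> = ereal v" using t by simp
  finally show False using v by simp
qed

lemma convex_on_real_of_ereal:
  assumes f: "epi_convex f" and fin: "\<And>x. f x \<noteq> -\<infinity>"
  shows "convex_on (eff_dom f) (\<lambda>x. real_of_ereal (f x))"
proof (rule convex_onI)
  fix t x y assume t: "0 < t" "t < (1::real)" and xy: "x \<in> eff_dom f" "y \<in> eff_dom f"
  let ?z = "(1 - t) *\<^sub>R x + t *\<^sub>R y"
  have z: "?z \<in> eff_dom f" using convex_eff_dom[OF f] xy t by (simp add: convex_alt)
  have real: "f w = ereal (real_of_ereal (f w))" if "w \<in> eff_dom f" for w
    using that fin[of w] by (cases "f w") (auto simp: eff_dom_def)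
  show "real_of_ereal (f ?z) \<le> (1 - t) * real_of_ereal (f x) + t * real_of_ereal (f y)"
  proof (rule field_le_epsilon)
    fix e :: real assume e: "e > 0"
    have "f (t *\<^sub>R y + (1 - t) *\<^sub>R x)
        \<le> ereal (t * (real_of_ereal (f y) + e) + (1 - t) * (real_of_ereal (f x) + e))"
      proof (intro epi_convexD[OF f])
      show "f y < ereal (real_of_ereal (f y) + e)" using e by (subst real[OF xy(2)]) simp
      show "f x < ereal (real_of_ereal (f x) + e)" using e by (subst real[OF xy(1)]) simp
    qed (use t in auto)
    then have "ereal (real_of_ereal (f ?z))
        \<le> ereal (t * (real_of_ereal (f y) + e) + (1 - t) * (real_of_ereal (f x) + e))"
      using real[OF z] by (simp add: add.commute)
    then show "real_of_ereal (f ?z) \<le> (1 - t) * real_of_ereal (f x) + t * real_of_ereal (f y) + e"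
      by (simp add: algebra_simps)
  qed
qed (rule convex_eff_dom[OF f])

section \<open>Convexity of the rate function\<close>

text \<open>The form in which the conjugate is used: upper bounds on it correspond to affine minorants of
  \<open>\<mu>\<close>.\<close>

lemma rate_le_iff: "rate \<mu> y \<le> ereal b \<longleftrightarrow> (\<forall>x. ereal (x \<bullet> y - b) \<le> \<mu> x)"
proof -
  have "ereal r - m \<le> ereal b \<longleftrightarrow> ereal (r - b) \<le> m" for r and m :: ereal
    by (cases m) auto
  then show ?thesis by (simp add: rate_def SUP_le_iff)
qed

lemma epi_convex_rate: "epi_convex (rate \<mu>)"
  unfolding epi_convex_def
proof (intro allI impI)
  fix x y b c and t :: real
  assume t: "0 \<le> t" "t \<le> 1" and xy: "rate \<mu> x < ereal b" "rate \<mu> y < ereal c"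
  show "rate \<mu> (t *\<^sub>R x + (1 - t) *\<^sub>R y) \<le> ereal (t * b + (1 - t) * c)"
    unfolding rate_le_iff
  proof
    fix z
    have *: "ereal (z \<bullet> x - b) \<le> \<mu> z" "ereal (z \<bullet> y - c) \<le> \<mu> z"
      using less_imp_le[OF xy(1)] less_imp_le[OF xy(2)] by (auto simp: rate_le_iff)
    have eq: "z \<bullet> (t *\<^sub>R x + (1 - t) *\<^sub>R y) - (t * b + (1 - t) * c)
        = t * (z \<bullet> x - b) + (1 - t) * (z \<bullet> y - c)"
      by (simp add: inner_add_right algebra_simps)
    show "ereal (z \<bullet> (t *\<^sub>R x + (1 - t) *\<^sub>R y) - (t * b + (1 - t) * c)) \<le> \<mu> z"
    proof (cases "\<mu> z")
      case (real m)
      then have "z \<bullet> x - b \<le> m" "z \<bullet> y - c \<le> m" using * by auto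
      then have "t * (z \<bullet> x - b) + (1 - t) * (z \<bullet> y - c) \<le> m"
        using t by (intro convex_bound_le) auto
      then show ?thesis using real eq by simp
    qed (use * in auto)
  qed
qed

section \<open>Gradients and convexity\<close>

lemma gderiv_imp_tendsto_right:
  fixes f :: "'a::real_inner \<Rightarrow> real"
  assumes "GDERIV f x :> v"
  shows "((\<lambda>t. (f (x + t *\<^sub>R d) - f x) / t) \<longlongrightarrow> v \<bullet> d) (at_right 0)"
proof -
  have "((\<lambda>t. x + t *\<^sub>R d) has_derivative (\<lambda>t. t *\<^sub>R d)) (at 0)"
    by (auto intro!: derivative_eq_intros)
  moreover have "(f has_derivative (\<lambda>h. h \<bullet> v)) (at (x + 0 *\<^sub>R d))"
    using assms by (simp add: gderiv_def)
  ultimately have "((\<lambda>t. f (x + t *\<^sub>R d)) has_derivative (\<lambda>t. (t *\<^sub>R d) \<bullet> v)) (at 0)"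
    by (rule has_derivative_compose)
  then have "((\<lambda>t. f (x + t *\<^sub>R d)) has_field_derivative (v \<bullet> d)) (at 0)"
    unfolding has_field_derivative_def
    by (rule has_derivative_eq_rhs) (auto simp: inner_commute)
  then have "((\<lambda>t. (f (x + t *\<^sub>R d) - f x) / t) \<longlongrightarrow> v \<bullet> d) (at 0)"
    by (simp add: DERIV_def)
  then show ?thesis by (rule filterlim_mono) (auto simp: at_within_le_at at_le)
qed

lemma eventually_at_right_0_unit:
  assumes "\<And>t::real. 0 < t \<Longrightarrow> t < 1 \<Longrightarrow> P t"
  shows "eventually P (at_right 0)"
  unfolding eventually_at_right_field using assms by (intro exI[of _ 1]) auto

lemma convex_on_gradient_le:
  fixes f :: "'a::real_inner \<Rightarrow> real"
  assumes f: "convex_on S f" and x: "x \<in> S" "z \<in> S" and v: "GDERIV f x :> v"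
  shows "f x + v \<bullet> (z - x) \<le> f z"
proof -
  have "v \<bullet> (z - x) \<le> f z - f x"
  proof (rule tendsto_upperbound[OF gderiv_imp_tendsto_right[OF v]])
    show "\<forall>\<^sub>F t in at_right 0. (f (x + t *\<^sub>R (z - x)) - f x) / t \<le> f z - f x"
    proof (rule eventually_at_right_0_unit)
      fix t :: real assume t: "0 < t" "t < 1"
      have "f ((1 - t) *\<^sub>R x + t *\<^sub>R z) \<le> (1 - t) * f x + t * f z"
        using t x by (intro convex_onD[OF f]) auto
      also have "(1 - t) *\<^sub>R x + t *\<^sub>R z = x + t *\<^sub>R (z - x)" by (simp add: algebra_simps)
      finally show "(f (x + t *\<^sub>R (z - x)) - f x) / t \<le> f z - f x"
        using t by (subst pos_divide_le_eq) (simp_all add: algebra_simps)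
    qed
  qed simp
  then show ?thesis by simp
qed

lemma gradient_nonneg_at_minimum:
  fixes f :: "'a::real_inner \<Rightarrow> real"
  assumes K: "convex K" and x: "x \<in> K" "z \<in> K" and min: "\<And>w. w \<in> K \<Longrightarrow> f x \<le> f w"
    and v: "GDERIV f x :> v"
  shows "0 \<le> v \<bullet> (z - x)"
proof (rule tendsto_lowerbound[OF gderiv_imp_tendsto_right[OF v]])
  show "\<forall>\<^sub>F t in at_right 0. 0 \<le> (f (x + t *\<^sub>R (z - x)) - f x) / t"
  proof (rule eventually_at_right_0_unit)
    fix t :: real assume t: "0 < t" "t < 1"
    have "(1 - t) *\<^sub>R x + t *\<^sub>R z \<in> K" using t x K by (simp add: convex_alt)
    also have "(1 - t) *\<^sub>R x + t *\<^sub>R z = x + t *\<^sub>R (z - x)" by (simp add: algebra_simps)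
    finally show "0 \<le> (f (x + t *\<^sub>R (z - x)) - f x) / t" using min t by simp
  qed
qed simp

lemma differentiable_imp_gderiv:
  fixes f :: "'a::euclidean_space \<Rightarrow> real"
  assumes "f differentiable (at x)"
  shows "\<exists>v. GDERIV f x :> v"
proof -
  obtain f' where f': "(f has_derivative f') (at x)" using assms by (auto simp: differentiable_def)
  then have "linear f'" by (rule has_derivative_linear)
  then have "f' = (\<lambda>h. h \<bullet> adjoint f' 1)" by (auto simp: adjoint_works)
  then show ?thesis using f' unfolding gderiv_def by metis
qed

section \<open>Conjugates of essentially smooth convex functions\<close>

locale essentially_smooth_convex =
  fixes \<mu> :: "'a::euclidean_space \<Rightarrow> ereal"
  assumes epi_convex: "epi_convex \<mu>"
    and zero: "\<mu> 0 = 0"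
    and zero_interior: "0 \<in> interior (eff_dom \<mu>)"
    and smooth: "essentially_smooth \<mu>"
begin

abbreviation "D \<equiv> interior (eff_dom \<mu>)"
abbreviation "DI \<equiv> interior (eff_dom (rate \<mu>))"

text \<open>\<open>\<mu>\<^sub>r\<close> and \<open>I\<close> are the real-valued versions of \<open>\<mu>\<close> and of its conjugate. They carry information
  only on the effective domains, where the originals are finite (\<open>\<mu>_eq_\<mu>\<^sub>r\<close>, \<open>rate_eq_I\<close>).\<close>

definition "\<mu>\<^sub>r x = real_of_ereal (\<mu> x)"
definition "I y = real_of_ereal (rate \<mu> y)"

lemma not_MInf: "\<mu> x \<noteq> -\<infinity>"
  by (rule epi_convex_not_MInf[OF epi_convex zero_interior]) (simp add: zero)

lemma \<mu>_eq_\<mu>\<^sub>r: "x \<in> eff_dom \<mu> \<Longrightarrow> \<mu> x = ereal (\<mu>\<^sub>r x)"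
  using not_MInf[of x] by (cases "\<mu> x") (auto simp: eff_dom_def \<mu>\<^sub>r_def)

lemma convex_on_\<mu>\<^sub>r: "convex_on (eff_dom \<mu>) \<mu>\<^sub>r"
  unfolding \<mu>\<^sub>r_def by (rule convex_on_real_of_ereal[OF epi_convex not_MInf])

lemma \<mu>\<^sub>r_0: "\<mu>\<^sub>r 0 = 0" by (simp add: \<mu>\<^sub>r_def zero)

lemma rate_nonneg: "0 \<le> rate \<mu> y"
  unfolding rate_def by (rule SUP_upper2[of 0]) (auto simp: zero)

lemma rate_eq_I: "y \<in> eff_dom (rate \<mu>) \<Longrightarrow> rate \<mu> y = ereal (I y)"
  using rate_nonneg[of y] by (cases "rate \<mu> y") (auto simp: eff_dom_def I_def)

lemma le_I:
  assumes "y \<in> eff_dom (rate \<mu>)" "x \<in> eff_dom \<mu>"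
  shows "x \<bullet> y - \<mu>\<^sub>r x \<le> I y"
proof -
  have "rate \<mu> y \<le> ereal (I y)" using rate_eq_I[OF assms(1)] by simp
  then show ?thesis unfolding rate_le_iff using \<mu>_eq_\<mu>\<^sub>r[OF assms(2)]
    by (metis diff_le_eq diff_diff_eq2 ereal_less_eq(3) add.commute)
qed

lemma continuous_on_I: "continuous_on DI I"
proof (rule convex_on_continuous)
  have "convex_on (eff_dom (rate \<mu>)) I"
    unfolding I_def using rate_nonneg
    by (intro convex_on_real_of_ereal[OF epi_convex_rate]) (metis MInfty_neq_ereal(1) ereal_infty_less_eq(2) zero_ereal_def)
  then show "convex_on DI I"
    by (rule convex_on_subset) (auto simp: interior_subset convex_interior convex_eff_dom[OF epi_convex_rate])
qed simp

text \<open>\<open>I\<close> is continuous on \<open>DI\<close>, so its value at a boundary point of a set is approached from the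
  set itself.\<close>

lemma ex_I_less_near:
  assumes a: "a \<in> DI" "a \<in> closure S" and c: "I a < c"
  obtains y where "y \<in> S" "y \<in> DI" "I y < c"
proof -
  have "(I \<longlongrightarrow> I a) (at a)"
    using continuous_on_I a(1) by (simp add: continuous_on_eq_continuous_at continuous_at)
  then have "\<forall>\<^sub>F y in nhds a. I y < c"
    using order_tendstoD(2)[OF _ c] by (simp add: tendsto_at_iff_tendsto_nhds)
  moreover have "\<forall>\<^sub>F y in nhds a. y \<in> DI" using a(1) by (intro eventually_nhds_in_open) auto
  ultimately have "\<forall>\<^sub>F y in nhds a. I y < c \<and> y \<in> DI" by eventually_elim simp
  then obtain U where U: "open U" "a \<in> U" "\<And>y. y \<in> U \<Longrightarrow> I y < c \<and> y \<in> DI"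
    by (auto simp: eventually_nhds)
  then obtain y where "y \<in> S" "y \<in> U"
    using a(2) open_Int_closure_eq_empty[OF U(1), of S] by auto
  then show thesis using that U(3) by blast
qed

lemma I_pos:
  assumes a: "a \<in> DI" "a \<in> closure E" and E: "rate_set \<mu> E > 0"
  shows "I a > 0"
proof -
  obtain c where c: "0 < c" "ereal c < rate_set \<mu> E"
    using ereal_dense2[OF E] by auto
  have "c \<le> I a"
  proof (rule ccontr)
    assume "\<not> c \<le> I a"
    then obtain y where y: "y \<in> E" "y \<in> DI" "I y < c"
      using ex_I_less_near[OF a, of c] by auto
    have "rate_set \<mu> E \<le> rate \<mu> y" unfolding rate_set_def using y(1) by (rule INF_lower)
    also have "\<dots> = ereal (I y)" using y(2) interior_subset by (intro rate_eq_I) blast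
    also have "\<dots> < ereal c" using y(3) by simp
    finally show False using c by simp
  qed
  then show ?thesis using c by simp
qed

lemma has_gradientD:
  assumes "has_gradient \<mu> s v"
  shows "s \<in> D" "GDERIV \<mu>\<^sub>r s :> v"
  using assms unfolding has_gradient_def \<mu>\<^sub>r_def[abs_def] by auto

text \<open>A gradient is the slope of an affine minorant that touches \<open>\<mu>\<close> at \<open>s\<close>, so the supremum that
  defines the conjugate is attained there.\<close>

lemma I_at_gradient:
  assumes "has_gradient \<mu> s v"
  shows "v \<in> eff_dom (rate \<mu>)" "I v = s \<bullet> v - \<mu>\<^sub>r s"
proof -
  have s: "s \<in> D" "GDERIV \<mu>\<^sub>r s :> v" using has_gradientD[OF assms] by auto
  then have s': "s \<in> eff_dom \<mu>" using interior_subset by blast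
  have "rate \<mu> v \<le> ereal (s \<bullet> v - \<mu>\<^sub>r s)"
    unfolding rate_le_iff
  proof
    fix x
    show "ereal (x \<bullet> v - (s \<bullet> v - \<mu>\<^sub>r s)) \<le> \<mu> x"
    proof (cases "x \<in> eff_dom \<mu>")
      case True
      have "\<mu>\<^sub>r s + v \<bullet> (x - s) \<le> \<mu>\<^sub>r x"
        by (rule convex_on_gradient_le[OF convex_on_\<mu>\<^sub>r s' True s(2)])
      then show ?thesis using \<mu>_eq_\<mu>\<^sub>r[OF True]
        by (simp add: inner_diff_right inner_commute[of v] algebra_simps)
    next
      case False
      then show ?thesis by (simp add: eff_dom_def)
    qed
  qed
  then show dom: "v \<in> eff_dom (rate \<mu>)" by (auto simp: eff_dom_def less_top)
  show "I v = s \<bullet> v - \<mu>\<^sub>r s"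
    using \<open>rate \<mu> v \<le> _\<close> le_I[OF dom s'] rate_eq_I[OF dom] by simp
qed

lemma gradient_exists:
  assumes "x \<in> D"
  shows "\<exists>v. GDERIV \<mu>\<^sub>r x :> v"
proof -
  have "\<mu>\<^sub>r differentiable_on D" using smooth unfolding essentially_smooth_def \<mu>\<^sub>r_def[abs_def] by simp
  then have "\<mu>\<^sub>r differentiable (at x)"
    using assms by (metis differentiable_on_eq_differentiable_at open_interior)
  then show ?thesis by (rule differentiable_imp_gderiv)
qed

text \<open>On a small ball around \<open>y\<close> the conjugate is bounded by some \<open>C\<close>, which gives one affine
  minorant of \<open>\<mu>\<close> for every slope in the ball. For a given \<open>x\<close> the slope \<open>y + r *\<^sub>R sgn x\<close> is the
  best one.\<close>

lemma coercive:
  assumes y: "y \<in> DI"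
  obtains r C where "r > 0" "\<And>x. x \<in> D \<Longrightarrow> r * norm x - C \<le> \<mu>\<^sub>r x - x \<bullet> y"
proof -
  obtain r where r: "r > 0" "cball y r \<subseteq> DI"
    using open_contains_cball[THEN iffD1, OF open_interior, rule_format, OF y] by auto
  have "compact (I ` cball y r)"
    by (intro compact_continuous_image continuous_on_subset[OF continuous_on_I r(2)]) auto
  then obtain C where C: "\<And>u. u \<in> cball y r \<Longrightarrow> I u \<le> C"
    using compact_imp_bounded[of "I ` cball y r"] unfolding bounded_real
    by (metis abs_le_D1 imageI)
  show thesis
  proof (rule that[OF r(1), of C])
    fix x assume x: "x \<in> D"
    let ?u = "y + r *\<^sub>R sgn x"
    have u: "?u \<in> cball y r" using r(1) by (simp add: dist_norm norm_sgn)
    then have "x \<bullet> ?u - \<mu>\<^sub>r x \<le> C"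
      using le_I[of ?u x] C[OF u] x r(2) interior_subset by (meson order_trans subsetD)
    moreover have "x \<bullet> sgn x = norm x"
      by (cases "x = 0") (simp_all add: sgn_div_norm power2_norm_eq_inner[symmetric] power2_eq_square)
    ultimately show "r * norm x - C \<le> \<mu>\<^sub>r x - x \<bullet> y"
      by (simp add: inner_add_right)
  qed
qed

text \<open>A point \<open>s\<close> with gradient \<open>y\<close> is a minimum of \<open>g x = \<mu>\<^sub>r x - x \<bullet> y\<close>. Lower semicontinuity of
  \<open>\<mu>\<close> at the boundary of its domain is not available, so \<open>g\<close> is minimised over compact convex sets
  \<open>K n\<close> in the interior: the part of the closed domain in a large ball, shrunk towards the origin.
  All \<open>K n\<close> contain a fixed ball around the origin, and testing minimality at the point of that ball
  opposite to the gradient bounds the gradients at the minima \<open>x n\<close> uniformly in \<open>n\<close>. By steepness a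
  limit point of \<open>x n\<close> cannot lie on the boundary, and so it is a minimum of \<open>g\<close> in the interior.\<close>

lemma gradient_surjective:
  assumes y: "y \<in> DI"
  shows "\<exists>s. has_gradient \<mu> s y"
proof -
  obtain G where G: "\<And>x. x \<in> D \<Longrightarrow> GDERIV \<mu>\<^sub>r x :> G x" using gradient_exists by metis
  define g where "g x = \<mu>\<^sub>r x - x \<bullet> y" for x
  have gG: "GDERIV g x :> G x - y" if "x \<in> D" for x
    using G[OF that] unfolding g_def[abs_def] gderiv_def
    by (auto intro!: derivative_eq_intros simp: inner_diff_right)
  have contg: "continuous (at x) g" if "x \<in> D" for x
    using gG[OF that] has_derivative_continuous unfolding gderiv_def by blast
  have convD: "convex D" by (intro convex_interior convex_eff_dom epi_convex)
  have g0: "g 0 = 0" by (simp add: g_def \<mu>\<^sub>r_0)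
  have convg: "convex_on D g"
    unfolding g_def
    by (intro convex_on_diff convex_on_subset[OF convex_on_\<mu>\<^sub>r interior_subset])
       (auto simp: convD concave_on_def convex_on_def inner_add_left)
  obtain r C where r: "r > 0" and coer: "\<And>x. x \<in> D \<Longrightarrow> r * norm x - C \<le> g x"
    using coercive[OF y] unfolding g_def by metis
  have C: "C \<ge> 0" using coer[OF zero_interior] g0 by simp
  (* By coercivity, g is positive on D outside cball 0 (C / r), so that points outside this ball do not compete with 0. *)
  define R where "R = C / r + 1"
  have R: "R > 0" using C r by (auto simp: R_def intro: add_nonneg_pos)
  obtain r0 where r0: "r0 > 0" "cball 0 r0 \<subseteq> D"
    using open_contains_cball[THEN iffD1, OF open_interior, rule_format, OF zero_interior] by auto
  define r1 where "r1 = min r0 R"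
  have r1: "r1 > 0" "r1 \<le> r0" "r1 \<le> R" using r0 R by (auto simp: r1_def)
  define t where "t n = 1 - 1 / real (n + 2)" for n
  have t: "1 / 2 \<le> t n" "t n < 1" for n by (auto simp: t_def field_simps)
  define L where "L = closure D \<inter> cball 0 R"
  have L: "compact L" "convex L"
    unfolding L_def by (auto intro!: closed_Int_compact convex_Int convex_closure convD)
  define K where "K n = (\<lambda>x. t n *\<^sub>R x) ` L" for n
  have K: "compact (K n)" "convex (K n)" for n
    unfolding K_def using L by (auto intro: compact_scaling convex_scaling)
  have KD: "K n \<subseteq> D" for n
  proof
    fix z assume "z \<in> K n"
    then obtain x where x: "x \<in> closure D" "z = t n *\<^sub>R x" by (auto simp: K_def L_def)
    have "x - (1 / real (n + 2)) *\<^sub>R (x - 0) \<in> interior D"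
      by (rule mem_interior_closure_convex_shrink[OF convD _ x(1)]) (use zero_interior in auto)
    moreover have "x - (1 / real (n + 2)) *\<^sub>R (x - 0) = z"
      unfolding x(2) t_def by (simp add: scaleR_left_diff_distrib)
    ultimately show "z \<in> D" by simp
  qed
  have KL: "K n \<subseteq> L" for n
  proof
    fix z assume z: "z \<in> K n"
    then obtain x where x: "norm x \<le> R" "z = t n *\<^sub>R x" by (auto simp: K_def L_def)
    have "norm z \<le> 1 * R"
      unfolding x(2) norm_scaleR using t[of n] x(1) by (intro mult_mono) auto
    moreover have "z \<in> closure D" using KD z closure_subset by blast
    ultimately show "z \<in> L" by (simp add: L_def)
  qed
  have ballK: "cball 0 (r1 / 2) \<subseteq> K n" for n
  proof
    fix z :: 'a assume z: "z \<in> cball 0 (r1 / 2)"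
    have "norm ((1 / t n) *\<^sub>R z) \<le> 2 * (r1 / 2)"
      unfolding norm_scaleR using t[of n] z by (intro mult_mono) (auto simp: field_simps)
    then have "(1 / t n) *\<^sub>R z \<in> cball 0 r0" "(1 / t n) *\<^sub>R z \<in> cball 0 R" using r1 by auto
    then have "(1 / t n) *\<^sub>R z \<in> L"
      using r0(2) closure_subset[of D] unfolding L_def by blast
    then show "z \<in> K n" unfolding K_def using t[of n]
      by (intro image_eqI[of _ _ "(1 / t n) *\<^sub>R z"]) auto
  qed
  have "\<exists>x\<in>K n. \<forall>z\<in>K n. g x \<le> g z" for n
  proof (rule continuous_attains_inf[OF K(1)])
    show "K n \<noteq> {}" using ballK[of n] r1 by force
    show "continuous_on (K n) g"
      using KD contg by (meson continuous_at_imp_continuous_on subsetD)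
  qed
  then obtain x where x: "\<And>n. x n \<in> K n" "\<And>n z. z \<in> K n \<Longrightarrow> g (x n) \<le> g z" by metis
  have xD: "x n \<in> D" for n using x(1) KD by blast
  have bound: "norm (G (x n)) \<le> 2 * C / r1 + norm y" for n
  proof -
    let ?v = "G (x n) - y"
    let ?z = "- (r1 / 2) *\<^sub>R sgn ?v"
    have "?z \<in> K n" using r1 by (intro subsetD[OF ballK]) (simp add: norm_sgn)
    then have "0 \<le> ?v \<bullet> (?z - x n)"
      by (intro gradient_nonneg_at_minimum[OF K(2) x(1) _ x(2) gG[OF xD]])
    moreover have "?v \<bullet> sgn ?v = norm ?v"
      by (cases "?v = 0") (simp_all add: sgn_div_norm power2_norm_eq_inner[symmetric] power2_eq_square)
    moreover have "g (x n) + ?v \<bullet> (0 - x n) \<le> g 0"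
      by (rule convex_on_gradient_le[OF convg xD zero_interior gG[OF xD]])
    moreover have "g (x n) \<ge> - C"
      using coer[OF xD[of n]] mult_nonneg_nonneg[OF less_imp_le[OF r] norm_ge_zero[of "x n"]] by linarith
    ultimately have "r1 / 2 * norm ?v \<le> C" using g0 by (simp add: inner_diff_right)
    then have "norm ?v \<le> 2 * C / r1" using r1 by (simp add: field_simps)
    then show ?thesis using norm_triangle_sub[of "G (x n)" y] by linarith
  qed
  obtain l \<phi> where l: "l \<in> L" and \<phi>: "strict_mono \<phi>" and lim: "(x \<circ> \<phi>) \<longlonglongrightarrow> l"
    using L(1) x(1) KL unfolding compact_def by (metis subsetD)
  have lD: "l \<in> D"
  proof (rule ccontr)
    assume "l \<notin> D"
    then have "l \<in> frontier D" using l by (simp add: L_def frontier_def)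
    moreover have "has_gradient \<mu> ((x \<circ> \<phi>) n) (G (x (\<phi> n)))" for n
      using G xD unfolding has_gradient_def \<mu>\<^sub>r_def[abs_def] by simp
    ultimately have "filterlim (\<lambda>n. norm (G (x (\<phi> n)))) at_top sequentially"
      using smooth[unfolded essentially_smooth_def steep_def, THEN conjunct2, THEN conjunct2, rule_format,
          of "x \<circ> \<phi>" "\<lambda>n. G (x (\<phi> n))" l] lim xD by simp
    then have "\<forall>\<^sub>F n in sequentially. 2 * C / r1 + norm y + 1 \<le> norm (G (x (\<phi> n)))"
      by (simp add: filterlim_at_top)
    then obtain n where "2 * C / r1 + norm y + 1 \<le> norm (G (x (\<phi> n)))"
      by (meson eventually_happens sequentially_bot)
    then show False using bound[of "\<phi> n"] by linarith
  qed
  have min: "g l \<le> g z" if z: "z \<in> D \<inter> ball 0 R" for z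
  proof (rule LIMSEQ_le)
    show "(\<lambda>n. g ((x \<circ> \<phi>) n)) \<longlonglongrightarrow> g l"
      by (rule isCont_tendsto_compose[OF contg[OF lD] lim])
    have "(\<lambda>n. 1 - 1 / real (n + 2)) \<longlonglongrightarrow> 1 - 0"
      by (intro tendsto_diff tendsto_const LIMSEQ_ignore_initial_segment lim_1_over_n)
    then have "t \<longlonglongrightarrow> 1" by (simp add: t_def[abs_def])
    from tendsto_scaleR[OF LIMSEQ_subseq_LIMSEQ[OF this \<phi>] tendsto_const[of z]]
    have "(\<lambda>n. t (\<phi> n) *\<^sub>R z) \<longlonglongrightarrow> z" by simp
    then show "(\<lambda>n. g (t (\<phi> n) *\<^sub>R z)) \<longlonglongrightarrow> g z"
      using z by (intro isCont_tendsto_compose[OF contg]) auto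
    have "z \<in> L" using z subsetD[OF closure_subset, of z D] by (auto simp: L_def)
    then show "\<exists>N. \<forall>n\<ge>N. g ((x \<circ> \<phi>) n) \<le> g (t (\<phi> n) *\<^sub>R z)"
      using x(2) unfolding K_def comp_def by blast
  qed
  have "g l \<le> 0" using min[of 0] R zero_interior g0 by simp
  then have "r * norm l \<le> C" using coer[OF lD] by linarith
  then have "norm l < R" using r by (simp add: R_def field_simps)
  then have "(\<lambda>h. h \<bullet> (G l - y)) = (\<lambda>h. 0)"
    using lD min gG[OF lD] unfolding gderiv_def
    by (intro differential_zero_maxmin[of l "D \<inter> ball 0 R" g]) auto
  then have "G l = y" by (metis inner_eq_zero_iff right_minus_eq)
  then show ?thesis using G[OF lD] lD unfolding has_gradient_def \<mu>\<^sub>r_def[abs_def] by blast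
qed

end

section \<open>The limiting cumulant generating function\<close>

lemma epi_convex_limit:
  assumes lim: "\<And>x. ((\<lambda>\<gamma>. F \<gamma> x) \<longlongrightarrow> f x) net" and F: "\<forall>\<^sub>F \<gamma> in net. epi_convex (F \<gamma>)"
    and net: "net \<noteq> bot"
  shows "epi_convex f"
  unfolding epi_convex_def
proof (intro allI impI)
  fix x y b c and t :: real
  assume t: "0 \<le> t" "t \<le> 1" and xy: "f x < ereal b" "f y < ereal c"
  show "f (t *\<^sub>R x + (1 - t) *\<^sub>R y) \<le> ereal (t * b + (1 - t) * c)"
  proof (rule tendsto_upperbound[OF lim _ net])
    show "\<forall>\<^sub>F \<gamma> in net. F \<gamma> (t *\<^sub>R x + (1 - t) *\<^sub>R y) \<le> ereal (t * b + (1 - t) * c)"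
      using order_tendstoD(2)[OF lim xy(1)] order_tendstoD(2)[OF lim xy(2)] F
      by eventually_elim (rule epi_convexD[OF _ t])
  qed
qed

lemma exp_decay_tendsto_0:
  fixes h :: "real \<Rightarrow> real"
  assumes "(h \<longlongrightarrow> l) at_top" "l < 0"
  shows "((\<lambda>\<gamma>. exp (\<gamma> * h \<gamma>)) \<longlongrightarrow> 0) at_top"
proof -
  have "filterlim (\<lambda>\<gamma>. \<gamma> * h \<gamma>) at_bot at_top"
    using filterlim_tendsto_neg_mult_at_bot[OF assms filterlim_ident] by (simp add: mult.commute)
  then show ?thesis by (rule filterlim_compose[OF exp_at_bot])
qed

lemma eventually_exp_decay_le:
  fixes h :: "real \<Rightarrow> real"
  assumes "(h \<longlongrightarrow> l) at_top" "l < 0" "\<eta> > 0"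
  shows "\<forall>\<^sub>F \<gamma> in at_top. exp (\<gamma> * h \<gamma>) \<le> \<eta>"
  using order_tendstoD(2)[OF exp_decay_tendsto_0[OF assms(1,2)] assms(3)]
  by eventually_elim simp

locale ld_family = prob_space M
  for M :: "'w measure" +
  fixes X :: "real \<Rightarrow> 'w \<Rightarrow> 'a::euclidean_space" and \<mu> :: "'a \<Rightarrow> ereal"
  assumes measurable_X: "\<And>\<gamma>. \<gamma> > 0 \<Longrightarrow> X \<gamma> \<in> borel_measurable M"
    and A: "assumption_A M X \<mu>"
begin

text \<open>Where the scaled cumulant generating function is infinite, \<open>\<kappa>\<close> has the meaningless value \<open>0\<close>.
  At points of the effective domain of \<open>\<mu>\<close> this happens only for small \<open>\<gamma>\<close>.\<close>

definition \<kappa> :: "real \<Rightarrow> 'a \<Rightarrow> real" where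
  "\<kappa> \<gamma> x = real_of_ereal (scaled_cgf M X \<gamma> x)"

abbreviation mgf :: "real \<Rightarrow> 'a \<Rightarrow> ennreal" where
  "mgf \<gamma> x \<equiv> (\<integral>\<^sup>+ \<omega>. ennreal (exp (x \<bullet> X \<gamma> \<omega>)) \<partial>M)"

lemma mgf_nonzero:
  assumes "\<gamma> > 0"
  shows "mgf \<gamma> x \<noteq> 0"
proof
  have [measurable]: "X \<gamma> \<in> borel_measurable M" by (rule measurable_X[OF assms])
  assume "mgf \<gamma> x = 0"
  then have "AE \<omega> in M. False" by (subst (asm) nn_integral_0_iff_AE) auto
  then show False by simp
qed

lemma
  assumes g: "\<gamma> > 0" and fin: "scaled_cgf M X \<gamma> x < \<infinity>"
  shows mgf_eq_exp: "mgf \<gamma> x = ennreal (exp (\<gamma> * \<kappa> \<gamma> x))"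
    and scaled_cgf_eq: "scaled_cgf M X \<gamma> x = ereal (\<kappa> \<gamma> x)"
proof -
  have top: "mgf \<gamma> x \<noteq> \<infinity>" using fin g by (auto simp: scaled_cgf_def elog_def)
  then have pos: "enn2real (mgf \<gamma> x) > 0" using mgf_nonzero[OF g, of x]
    by (simp add: enn2real_positive_iff less_top zero_less_iff_neq_zero)
  have s: "scaled_cgf M X \<gamma> x = ereal (ln (enn2real (mgf \<gamma> x)) / \<gamma>)"
    using top mgf_nonzero[OF g, of x] g by (simp add: scaled_cgf_def elog_def)
  then have k: "\<kappa> \<gamma> x = ln (enn2real (mgf \<gamma> x)) / \<gamma>" by (simp add: \<kappa>_def)
  show "scaled_cgf M X \<gamma> x = ereal (\<kappa> \<gamma> x)" using s k by simp
  show "mgf \<gamma> x = ennreal (exp (\<gamma> * \<kappa> \<gamma> x))"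
    using k g pos top by (simp add: less_top)
qed

lemma scaled_cgf_le:
  assumes g: "\<gamma> > 0" and le: "mgf \<gamma> x \<le> ennreal (exp (\<gamma> * b))"
  shows "scaled_cgf M X \<gamma> x \<le> ereal b"
proof -
  have top: "mgf \<gamma> x < \<infinity>" using le by (auto simp: less_top[symmetric] top_unique)
  have "scaled_cgf M X \<gamma> x < \<infinity>"
    using top g by (auto simp: scaled_cgf_def elog_def divide_ereal_def)
  from mgf_eq_exp[OF g this] scaled_cgf_eq[OF g this] le g show ?thesis by simp
qed

text \<open>Hoelder's inequality for exponentials. After normalising both factors to have integral \<open>1\<close> it
  is the convexity of \<open>exp\<close> under the integral.\<close>

lemma epi_convex_scaled_cgf:
  assumes g: "\<gamma> > 0"
  shows "epi_convex (scaled_cgf M X \<gamma>)"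
  unfolding epi_convex_def
proof (intro allI impI)
  fix x y b c and t :: real
  assume t: "0 \<le> t" "t \<le> 1" and x: "scaled_cgf M X \<gamma> x < ereal b" and y: "scaled_cgf M X \<gamma> y < ereal c"
  have [measurable]: "X \<gamma> \<in> borel_measurable M" by (rule measurable_X[OF g])
  have fin: "scaled_cgf M X \<gamma> x < \<infinity>" "scaled_cgf M X \<gamma> y < \<infinity>" using x y by auto
  let ?L = "t * (\<gamma> * \<kappa> \<gamma> x) + (1 - t) * (\<gamma> * \<kappa> \<gamma> y)"
  let ?p = "t * exp (?L - \<gamma> * \<kappa> \<gamma> x)" and ?q = "(1 - t) * exp (?L - \<gamma> * \<kappa> \<gamma> y)"
  have "exp ((t *\<^sub>R x + (1 - t) *\<^sub>R y) \<bullet> v) \<le> ?p * exp (x \<bullet> v) + ?q * exp (y \<bullet> v)" for v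
  proof -
    have "exp ((t *\<^sub>R x + (1 - t) *\<^sub>R y) \<bullet> v)
        = exp ?L * exp (t * (x \<bullet> v - \<gamma> * \<kappa> \<gamma> x) + (1 - t) * (y \<bullet> v - \<gamma> * \<kappa> \<gamma> y))"
      by (simp add: exp_add[symmetric] inner_add_left algebra_simps)
    also have "\<dots> \<le> exp ?L * (t * exp (x \<bullet> v - \<gamma> * \<kappa> \<gamma> x) + (1 - t) * exp (y \<bullet> v - \<gamma> * \<kappa> \<gamma> y))"
      using convex_onD[OF exp_convex, of "1 - t" "x \<bullet> v - \<gamma> * \<kappa> \<gamma> x" "y \<bullet> v - \<gamma> * \<kappa> \<gamma> y"] t
      by (intro mult_left_mono) auto
    also have "\<dots> = ?p * exp (x \<bullet> v) + ?q * exp (y \<bullet> v)"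
      by (simp add: exp_diff exp_add field_simps)
    finally show ?thesis .
  qed
  then have "mgf \<gamma> (t *\<^sub>R x + (1 - t) *\<^sub>R y)
      \<le> (\<integral>\<^sup>+ \<omega>. ennreal ?p * ennreal (exp (x \<bullet> X \<gamma> \<omega>)) + ennreal ?q * ennreal (exp (y \<bullet> X \<gamma> \<omega>)) \<partial>M)"
    using t by (intro nn_integral_mono)
      (simp add: ennreal_mult[symmetric] ennreal_plus[symmetric] ennreal_leI del: ennreal_plus)
  also have "\<dots> = ennreal ?p * mgf \<gamma> x + ennreal ?q * mgf \<gamma> y"
    by (simp add: nn_integral_add nn_integral_cmult)
  also have "\<dots> = ennreal (?p * exp (\<gamma> * \<kappa> \<gamma> x) + ?q * exp (\<gamma> * \<kappa> \<gamma> y))"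
    unfolding mgf_eq_exp[OF g fin(1)] mgf_eq_exp[OF g fin(2)] using t
    by (simp add: ennreal_mult[symmetric] ennreal_plus[symmetric] del: ennreal_plus)
  also have "?p * exp (\<gamma> * \<kappa> \<gamma> x) + ?q * exp (\<gamma> * \<kappa> \<gamma> y) = exp (\<gamma> * (t * \<kappa> \<gamma> x + (1 - t) * \<kappa> \<gamma> y))"
    by (simp add: mult.assoc exp_add[symmetric] algebra_simps)
  finally have "scaled_cgf M X \<gamma> (t *\<^sub>R x + (1 - t) *\<^sub>R y) \<le> ereal (t * \<kappa> \<gamma> x + (1 - t) * \<kappa> \<gamma> y)"
    by (rule scaled_cgf_le[OF g])
  also have "\<dots> \<le> ereal (t * b + (1 - t) * c)"
    using x y t unfolding scaled_cgf_eq[OF g fin(1)] scaled_cgf_eq[OF g fin(2)]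
    by (auto intro!: add_mono mult_left_mono)
  finally show "scaled_cgf M X \<gamma> (t *\<^sub>R x + (1 - t) *\<^sub>R y) \<le> ereal (t * b + (1 - t) * c)" .
qed

lemma lim_scaled_cgf: "((\<lambda>\<gamma>. scaled_cgf M X \<gamma> x) \<longlongrightarrow> \<mu> x) at_top"
  using A unfolding assumption_A_def by blast

sublocale essentially_smooth_convex \<mu>
proof
  have "\<forall>\<^sub>F \<gamma> in at_top. epi_convex (scaled_cgf M X \<gamma>)"
    using eventually_gt_at_top[of 0] by eventually_elim (rule epi_convex_scaled_cgf)
  then show "epi_convex \<mu>" by (intro epi_convex_limit[OF lim_scaled_cgf]) auto
  have "scaled_cgf M X \<gamma> 0 = 0" for \<gamma>
    by (simp add: scaled_cgf_def elog_def emeasure_space_1 zero_ereal_def[symmetric])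
  then have "((\<lambda>\<gamma>::real. 0::ereal) \<longlongrightarrow> \<mu> 0) at_top"
    using lim_scaled_cgf[of 0] by simp
  then show "\<mu> 0 = 0" by (simp add: tendsto_const_iff)
qed (use A in \<open>auto simp: assumption_A_def\<close>)

lemma
  assumes "x \<in> eff_dom \<mu>"
  shows eventually_scaled_cgf_finite: "\<forall>\<^sub>F \<gamma> in at_top. \<gamma> > 0 \<and> scaled_cgf M X \<gamma> x < \<infinity>"
    and tendsto_\<kappa>: "((\<lambda>\<gamma>. \<kappa> \<gamma> x) \<longlongrightarrow> \<mu>\<^sub>r x) at_top"
proof -
  show "\<forall>\<^sub>F \<gamma> in at_top. \<gamma> > 0 \<and> scaled_cgf M X \<gamma> x < \<infinity>"
    using order_tendstoD(2)[OF lim_scaled_cgf, of x \<infinity>] eventually_gt_at_top[of "0::real"] assms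
    by (intro eventually_conj) (auto simp: eff_dom_def)
  show "((\<lambda>\<gamma>. \<kappa> \<gamma> x) \<longlongrightarrow> \<mu>\<^sub>r x) at_top"
    unfolding \<kappa>_def using lim_scaled_cgf[of x] \<mu>_eq_\<mu>\<^sub>r[OF assms] by (intro lim_real_of_ereal) simp
qed

section \<open>Exponential tilting\<close>

definition tilt :: "real \<Rightarrow> 'a \<Rightarrow> 'w measure" where
  "tilt \<gamma> s = density M (\<lambda>\<omega>. ennreal (exp (s \<bullet> X \<gamma> \<omega> - \<gamma> * \<kappa> \<gamma> s)))"

lemma space_tilt[simp]: "space (tilt \<gamma> s) = space M" and sets_tilt[measurable_cong, simp]: "sets (tilt \<gamma> s) = sets M"
  by (simp_all add: tilt_def)

lemma nn_integral_exp_tilt: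
  assumes g: "\<gamma> > 0" and fin: "scaled_cgf M X \<gamma> (s + u) < \<infinity>"
  shows "(\<integral>\<^sup>+ \<omega>. ennreal (exp (u \<bullet> X \<gamma> \<omega>)) \<partial>tilt \<gamma> s) = ennreal (exp (\<gamma> * (\<kappa> \<gamma> (s + u) - \<kappa> \<gamma> s)))"
proof -
  have [measurable]: "X \<gamma> \<in> borel_measurable M" by (rule measurable_X[OF g])
  have "(\<integral>\<^sup>+ \<omega>. ennreal (exp (u \<bullet> X \<gamma> \<omega>)) \<partial>tilt \<gamma> s)
      = (\<integral>\<^sup>+ \<omega>. ennreal (exp (- \<gamma> * \<kappa> \<gamma> s)) * ennreal (exp ((s + u) \<bullet> X \<gamma> \<omega>)) \<partial>M)"
    unfolding tilt_def
    by (subst nn_integral_density)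
       (auto simp: ennreal_mult[symmetric] exp_add[symmetric] inner_add_left algebra_simps
             intro!: nn_integral_cong)
  also have "\<dots> = ennreal (exp (- \<gamma> * \<kappa> \<gamma> s)) * mgf \<gamma> (s + u)"
    by (rule nn_integral_cmult) simp
  also have "\<dots> = ennreal (exp (\<gamma> * (\<kappa> \<gamma> (s + u) - \<kappa> \<gamma> s)))"
    unfolding mgf_eq_exp[OF g fin]
    by (simp add: ennreal_mult[symmetric] exp_add[symmetric] algebra_simps)
  finally show ?thesis .
qed

lemma prob_space_tilt:
  assumes g: "\<gamma> > 0" and fin: "scaled_cgf M X \<gamma> s < \<infinity>"
  shows "prob_space (tilt \<gamma> s)"
  using nn_integral_exp_tilt[OF g, of s 0] fin by (intro prob_spaceI) simp

text \<open>The exponential Markov inequality under a tilted measure; for \<open>s = 0\<close> it is Chernoff's bound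
  for \<open>M\<close>.\<close>

lemma emeasure_tilt_halfspace_le:
  assumes g: "\<gamma> > 0" and fin: "scaled_cgf M X \<gamma> (s + u) < \<infinity>"
  shows "emeasure (tilt \<gamma> s) {\<omega> \<in> space M. u \<bullet> ((1 / \<gamma>) *\<^sub>R X \<gamma> \<omega>) \<ge> b}
    \<le> ennreal (exp (\<gamma> * (\<kappa> \<gamma> (s + u) - \<kappa> \<gamma> s - b)))"
proof -
  have [measurable]: "X \<gamma> \<in> borel_measurable M" by (rule measurable_X[OF g])
  let ?H = "{\<omega> \<in> space M. u \<bullet> ((1 / \<gamma>) *\<^sub>R X \<gamma> \<omega>) \<ge> b}"
  have "emeasure (tilt \<gamma> s) ?H = (\<integral>\<^sup>+ \<omega>. indicator ?H \<omega> \<partial>tilt \<gamma> s)" by simp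
  also have "\<dots> \<le> (\<integral>\<^sup>+ \<omega>. ennreal (exp (- \<gamma> * b)) * ennreal (exp (u \<bullet> X \<gamma> \<omega>)) \<partial>tilt \<gamma> s)"
    using g by (intro nn_integral_mono)
      (auto simp: ennreal_mult[symmetric] exp_add[symmetric] field_simps split: split_indicator)
  also have "\<dots> = ennreal (exp (- \<gamma> * b)) * (\<integral>\<^sup>+ \<omega>. ennreal (exp (u \<bullet> X \<gamma> \<omega>)) \<partial>tilt \<gamma> s)"
    by (rule nn_integral_cmult) simp
  also have "\<dots> = ennreal (exp (\<gamma> * (\<kappa> \<gamma> (s + u) - \<kappa> \<gamma> s - b)))"
    unfolding nn_integral_exp_tilt[OF g fin]
    by (simp add: ennreal_mult[symmetric] exp_add[symmetric] algebra_simps)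
  finally show ?thesis .
qed

text \<open>With the additional tilting \<open>t *\<^sub>R u\<close> the exponent in the bound above tends to
  \<open>\<mu>\<^sub>r (s + t *\<^sub>R u) - \<mu>\<^sub>r s - t * (y \<bullet> u + \<delta>)\<close>. The derivative of \<open>\<mu>\<^sub>r\<close> at \<open>s\<close> in direction \<open>u\<close> is
  \<open>y \<bullet> u\<close>, so this is negative for small \<open>t > 0\<close>.\<close>

lemma tilt_halfspace_vanishes:
  assumes s: "has_gradient \<mu> s y" and u: "norm u = 1" and \<delta>: "\<delta> > 0" and \<eta>: "\<eta> > 0"
  shows "\<forall>\<^sub>F \<gamma> in at_top.
    measure (tilt \<gamma> s) {\<omega> \<in> space M. u \<bullet> ((1 / \<gamma>) *\<^sub>R X \<gamma> \<omega> - y) \<ge> \<delta>} \<le> \<eta>"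
proof -
  have sD: "s \<in> D" and v: "GDERIV \<mu>\<^sub>r s :> y" using has_gradientD[OF s] by auto
  have "\<forall>\<^sub>F t in at_right 0. (\<mu>\<^sub>r (s + t *\<^sub>R u) - \<mu>\<^sub>r s) / t < y \<bullet> u + \<delta>"
    by (rule order_tendstoD(2)[OF gderiv_imp_tendsto_right[OF v]]) (use \<delta> in simp)
  moreover have "((\<lambda>t. s + t *\<^sub>R u) \<longlongrightarrow> s + 0 *\<^sub>R u) (at_right 0)"
    by (intro tendsto_intros)
  then have "\<forall>\<^sub>F t in at_right 0. s + t *\<^sub>R u \<in> D"
    using sD by (intro topological_tendstoD) auto
  ultimately have "\<forall>\<^sub>F t in at_right 0. (\<mu>\<^sub>r (s + t *\<^sub>R u) - \<mu>\<^sub>r s) / t < y \<bullet> u + \<delta> \<and> s + t *\<^sub>R u \<in> D \<and> t > 0"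
    using eventually_at_right_less[of 0] by eventually_elim simp
  then obtain t where t: "(\<mu>\<^sub>r (s + t *\<^sub>R u) - \<mu>\<^sub>r s) / t < y \<bullet> u + \<delta>" "s + t *\<^sub>R u \<in> D" "t > 0"
    by (metis (mono_tags, lifting) eventually_happens' trivial_limit_at_right_real)
  let ?h = "\<lambda>\<gamma>. \<kappa> \<gamma> (s + t *\<^sub>R u) - \<kappa> \<gamma> s - t * (y \<bullet> u + \<delta>)"
  have dom: "s + t *\<^sub>R u \<in> eff_dom \<mu>" "s \<in> eff_dom \<mu>" using t(2) sD interior_subset by auto
  have "(?h \<longlongrightarrow> \<mu>\<^sub>r (s + t *\<^sub>R u) - \<mu>\<^sub>r s - t * (y \<bullet> u + \<delta>)) at_top"
    by (intro tendsto_diff tendsto_const tendsto_\<kappa> dom)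
  moreover have "\<mu>\<^sub>r (s + t *\<^sub>R u) - \<mu>\<^sub>r s - t * (y \<bullet> u + \<delta>) < 0"
    using t(1,3) by (simp add: field_simps)
  ultimately have "\<forall>\<^sub>F \<gamma> in at_top. exp (\<gamma> * ?h \<gamma>) \<le> \<eta>" using \<eta> by (rule eventually_exp_decay_le)
  with eventually_scaled_cgf_finite[OF dom(1)] show ?thesis
  proof eventually_elim
    case (elim \<gamma>)
    have "(t *\<^sub>R u) \<bullet> x \<ge> t * (y \<bullet> u + \<delta>) \<longleftrightarrow> u \<bullet> (x - y) \<ge> \<delta>" for x
      using t(3) by (simp add: inner_diff_right inner_commute[of y] le_diff_eq add.commute)
    then have "{\<omega> \<in> space M. u \<bullet> ((1 / \<gamma>) *\<^sub>R X \<gamma> \<omega> - y) \<ge> \<delta>}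
        = {\<omega> \<in> space M. (t *\<^sub>R u) \<bullet> ((1 / \<gamma>) *\<^sub>R X \<gamma> \<omega>) \<ge> t * (y \<bullet> u + \<delta>)}"
      by blast
    then have "emeasure (tilt \<gamma> s) {\<omega> \<in> space M. u \<bullet> ((1 / \<gamma>) *\<^sub>R X \<gamma> \<omega> - y) \<ge> \<delta>} \<le> ennreal (exp (\<gamma> * ?h \<gamma>))"
      using emeasure_tilt_halfspace_le[of \<gamma> s "t *\<^sub>R u"] elim by simp
    also have "\<dots> \<le> ennreal \<eta>" using elim by (intro ennreal_leI) simp
    finally show ?case using \<eta> by (simp add: measure_def enn2real_leI)
  qed
qed

text \<open>The complement of a ball is covered by finitely many half-spaces, two for each coordinate
  direction.\<close>

lemma tilt_concentrates:
  assumes s: "has_gradient \<mu> s y" and \<delta>: "\<delta> > 0"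
  shows "\<forall>\<^sub>F \<gamma> in at_top. 1 / 2 \<le> measure (tilt \<gamma> s) {\<omega> \<in> space M. dist ((1 / \<gamma>) *\<^sub>R X \<gamma> \<omega>) y < \<delta>}"
proof -
  define U where "U = (Basis :: 'a set) \<union> uminus ` Basis"
  have U: "finite U" "U \<noteq> {}" "\<And>u. u \<in> U \<Longrightarrow> norm u = 1" by (auto simp: U_def)
  define \<delta>' where "\<delta>' = \<delta> / DIM('a)"
  have \<delta>': "\<delta>' > 0" using \<delta> by (simp add: \<delta>'_def)
  have cover: "\<exists>u\<in>U. u \<bullet> (x - y) \<ge> \<delta>'" if "\<not> dist x y < \<delta>" for x
  proof (rule ccontr)
    assume neg: "\<not> ?thesis"
    have "\<bar>(x - y) \<bullet> b\<bar> < \<delta>'" if "b \<in> Basis" for b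
    proof -
      have "b \<in> U" "- b \<in> U" using that by (auto simp: U_def)
      with neg have "b \<bullet> (x - y) < \<delta>'" "(- b) \<bullet> (x - y) < \<delta>'" by (meson not_less)+
      then show ?thesis by (simp add: inner_commute)
    qed
    then have "(\<Sum>b\<in>Basis. \<bar>(x - y) \<bullet> b\<bar>) < (\<Sum>b\<in>(Basis::'a set). \<delta>')"
      by (intro sum_strict_mono) auto
    then have "norm (x - y) < \<delta>"
      using norm_le_l1[of "x - y"] by (simp add: \<delta>'_def)
    then show False using that by (simp add: dist_norm)
  qed
  have dom: "s \<in> eff_dom \<mu>" using has_gradientD(1)[OF s] interior_subset by auto
  have "\<forall>\<^sub>F \<gamma> in at_top. \<forall>u\<in>U.
      measure (tilt \<gamma> s) {\<omega> \<in> space M. u \<bullet> ((1 / \<gamma>) *\<^sub>R X \<gamma> \<omega> - y) \<ge> \<delta>'} \<le> 1 / (2 * card U)"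
    using U by (intro eventually_ball_finite ballI tilt_halfspace_vanishes[OF s] \<delta>') (auto simp: card_gt_0_iff)
  with eventually_scaled_cgf_finite[OF dom] show ?thesis
  proof eventually_elim
    case (elim \<gamma>)
    have [measurable]: "X \<gamma> \<in> borel_measurable M" using elim by (intro measurable_X) auto
    interpret T: prob_space "tilt \<gamma> s" using elim by (intro prob_space_tilt) auto
    let ?B = "{\<omega> \<in> space M. dist ((1 / \<gamma>) *\<^sub>R X \<gamma> \<omega>) y < \<delta>}"
    let ?H = "\<lambda>u. {\<omega> \<in> space M. u \<bullet> ((1 / \<gamma>) *\<^sub>R X \<gamma> \<omega> - y) \<ge> \<delta>'}"
    have [measurable]: "?B \<in> sets M" "\<And>u. ?H u \<in> sets M" by measurable
    have "1 - T.prob ?B = T.prob (space M - ?B)" by (subst T.prob_compl[symmetric]) auto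
    also have "\<dots> \<le> T.prob (\<Union>u\<in>U. ?H u)"
      using cover U(1) by (intro T.finite_measure_mono) auto
    also have "\<dots> \<le> (\<Sum>u\<in>U. T.prob (?H u))"
      using U by (intro T.finite_measure_subadditive_finite) auto
    also have "\<dots> \<le> (\<Sum>u\<in>U. 1 / (2 * card U))" using elim by (intro sum_mono) auto
    also have "\<dots> = 1 / 2" using U by simp
    finally show ?case by simp
  qed
qed

section \<open>Large deviation bounds\<close>

lemma chernoff:
  assumes s: "has_gradient \<mu> s y" and \<eta>: "\<eta> > 0"
  shows "\<forall>\<^sub>F \<gamma> in at_top.
    measure M {\<omega> \<in> space M. s \<bullet> ((1 / \<gamma>) *\<^sub>R X \<gamma> \<omega> - y) \<ge> 0} \<le> exp (- \<gamma> * (I y - \<eta>))"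
proof -
  have dom: "s \<in> eff_dom \<mu>" using has_gradientD(1)[OF s] interior_subset by auto
  have "\<forall>\<^sub>F \<gamma> in at_top. \<kappa> \<gamma> s < \<mu>\<^sub>r s + \<eta>"
    by (rule order_tendstoD(2)[OF tendsto_\<kappa>[OF dom]]) (use \<eta> in simp)
  with eventually_scaled_cgf_finite[OF dom] show ?thesis
  proof eventually_elim
    case (elim \<gamma>)
    have [measurable]: "X \<gamma> \<in> borel_measurable M" using elim by (intro measurable_X) auto
    have \<kappa>0: "\<kappa> \<gamma> 0 = 0"
      by (simp add: \<kappa>_def scaled_cgf_def elog_def emeasure_space_1)
    have "tilt \<gamma> 0 = M" by (simp add: tilt_def \<kappa>0 density_1)
    then have "emeasure M {\<omega> \<in> space M. s \<bullet> ((1 / \<gamma>) *\<^sub>R X \<gamma> \<omega>) \<ge> s \<bullet> y}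
        \<le> ennreal (exp (\<gamma> * (\<kappa> \<gamma> s - s \<bullet> y)))"
      using emeasure_tilt_halfspace_le[of \<gamma> 0 s "s \<bullet> y"] elim \<kappa>0 by simp
    also have "\<dots> \<le> ennreal (exp (- \<gamma> * (I y - \<eta>)))"
    proof -
      have "\<gamma> * (\<kappa> \<gamma> s - s \<bullet> y) \<le> \<gamma> * (- (I y - \<eta>))"
        using elim I_at_gradient(2)[OF s] by (intro mult_left_mono) auto
      then show ?thesis by (intro ennreal_leI) (simp add: right_diff_distrib)
    qed
    finally show ?case by (simp add: inner_diff_right measure_def enn2real_leI)
  qed
qed

text \<open>On a ball of radius \<open>d\<close> around \<open>y\<close> the density of the tilted measure is at most
  \<open>exp (\<gamma> * (s \<bullet> y + norm s * d - \<kappa> \<gamma> s))\<close>, whose exponent is \<open>\<gamma> * (I y + o(1))\<close> up to the term with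
  \<open>d\<close>; and the tilted measure of the ball is at least \<open>1 / 2\<close>.\<close>

lemma ld_lower_bound_ball:
  assumes y: "y \<in> DI" and \<delta>: "\<delta> > 0" and \<eta>: "\<eta> > 0"
  shows "\<forall>\<^sub>F \<gamma> in at_top.
    exp (- \<gamma> * (I y + \<eta>)) \<le> measure M {\<omega> \<in> space M. dist ((1 / \<gamma>) *\<^sub>R X \<gamma> \<omega>) y < \<delta>}"
proof -
  obtain s where s: "has_gradient \<mu> s y" using gradient_surjective[OF y] by blast
  have dom: "s \<in> eff_dom \<mu>" using has_gradientD(1)[OF s] interior_subset by auto
  (* The three parts eta / 3 pay for the radius d, for the convergence of kappa and for the factor 1 / 2. *)
  define d where "d = min \<delta> (\<eta> / (3 * (norm s + 1)))"
  have d: "d > 0" "d \<le> \<delta>" using \<delta> \<eta> by (auto simp: d_def intro!: divide_pos_pos add_nonneg_pos)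
  have "norm s * d \<le> (norm s + 1) * (\<eta> / (3 * (norm s + 1)))"
    using d(1) by (intro mult_mono) (auto simp: d_def)
  also have "\<dots> = \<eta> / 3" using norm_ge_zero[of s] by (simp add: field_simps add_nonneg_eq_0_iff)
  finally have sd: "norm s * d \<le> \<eta> / 3" .
  have "\<forall>\<^sub>F \<gamma> in at_top. \<kappa> \<gamma> s > \<mu>\<^sub>r s - \<eta> / 3"
    by (rule order_tendstoD(1)[OF tendsto_\<kappa>[OF dom]]) (use \<eta> in simp)
  moreover have "\<forall>\<^sub>F \<gamma> in at_top. exp (\<gamma> * (- \<eta> / 3)) \<le> 1 / 2"
    by (rule eventually_exp_decay_le[OF tendsto_const]) (use \<eta> in auto)
  moreover note tilt_concentrates[OF s d(1)] eventually_scaled_cgf_finite[OF dom]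
  ultimately show ?thesis
  proof eventually_elim
    case (elim \<gamma>)
    have g: "\<gamma> > 0" using elim by simp
    have [measurable]: "X \<gamma> \<in> borel_measurable M" by (rule measurable_X[OF g])
    interpret T: prob_space "tilt \<gamma> s" using elim by (intro prob_space_tilt) auto
    let ?B = "{\<omega> \<in> space M. dist ((1 / \<gamma>) *\<^sub>R X \<gamma> \<omega>) y < d}"
    let ?c = "\<gamma> * (s \<bullet> y + norm s * d) - \<gamma> * \<kappa> \<gamma> s"
    have [measurable]: "?B \<in> sets M" by measurable
    have le: "s \<bullet> X \<gamma> \<omega> - \<gamma> * \<kappa> \<gamma> s \<le> ?c" if "\<omega> \<in> ?B" for \<omega>
    proof -
      let ?x = "(1 / \<gamma>) *\<^sub>R X \<gamma> \<omega>"
      have "s \<bullet> (?x - y) \<le> norm s * norm (?x - y)" by (rule norm_cauchy_schwarz)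
      also have "\<dots> \<le> norm s * d" using that by (intro mult_left_mono) (auto simp: dist_norm)
      finally have "\<gamma> * (s \<bullet> ?x) \<le> \<gamma> * (s \<bullet> y + norm s * d)"
        using g by (intro mult_left_mono) (auto simp: inner_diff_right)
      then show ?thesis using g by simp
    qed
    have "emeasure (tilt \<gamma> s) ?B
        = (\<integral>\<^sup>+ \<omega>. ennreal (exp (s \<bullet> X \<gamma> \<omega> - \<gamma> * \<kappa> \<gamma> s)) * indicator ?B \<omega> \<partial>M)"
      unfolding tilt_def by (rule emeasure_density) auto
    also have "\<dots> \<le> (\<integral>\<^sup>+ \<omega>. ennreal (exp ?c) * indicator ?B \<omega> \<partial>M)"
      using le by (intro nn_integral_mono) (auto intro!: ennreal_leI split: split_indicator)
    also have "\<dots> = ennreal (exp ?c) * emeasure M ?B"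
      by (rule nn_integral_cmult_indicator) simp
    finally have "ennreal (T.prob ?B) \<le> ennreal (exp ?c * prob ?B)"
      by (simp add: T.emeasure_eq_measure emeasure_eq_measure ennreal_mult)
    then have half: "1 / 2 \<le> exp ?c * prob ?B" using elim by (simp add: mult_nonneg_nonneg)
    have "?c \<le> \<gamma> * (I y + 2 * \<eta> / 3)"
      unfolding I_at_gradient(2)[OF s] right_diff_distrib[symmetric]
      using g sd elim by (intro mult_left_mono) auto
    then have "exp (- \<gamma> * (I y + \<eta>)) \<le> exp (- ?c) * exp (\<gamma> * (- \<eta> / 3))"
      unfolding exp_add[symmetric] by (simp add: algebra_simps)
    also have "\<dots> \<le> exp (- ?c) * (1 / 2)" using elim by (intro mult_left_mono) auto
    also have "\<dots> \<le> exp (- ?c) * (exp ?c * prob ?B)" using half by (intro mult_left_mono) auto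
    also have "\<dots> = prob ?B" by (simp only: exp_minus mult.assoc[symmetric] left_inverse[OF exp_not_eq_zero] mult_1)
    also have "\<dots> \<le> prob {\<omega> \<in> space M. dist ((1 / \<gamma>) *\<^sub>R X \<gamma> \<omega>) y < \<delta>}"
      using d(2) by (intro finite_measure_mono) auto
    finally show ?case .
  qed
qed

lemma ld_lower_bound:
  assumes E: "E \<in> sets borel" and a: "a \<in> DI" "a \<in> closure (interior E)" and \<eta>: "\<eta> > 0"
  shows "\<forall>\<^sub>F \<gamma> in at_top. exp (- \<gamma> * (I a + \<eta>)) \<le> target_prob M X E \<gamma>"
proof -
  obtain y where y: "y \<in> interior E" "y \<in> DI" "I y < I a + \<eta> / 2"
    using ex_I_less_near[OF a, of "I a + \<eta> / 2"] \<eta> by auto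
  obtain \<delta> where \<delta>: "\<delta> > 0" "ball y \<delta> \<subseteq> E" using y(1) by (meson mem_interior)
  have "\<forall>\<^sub>F \<gamma> in at_top.
      exp (- \<gamma> * (I y + \<eta> / 2)) \<le> measure M {\<omega> \<in> space M. dist ((1 / \<gamma>) *\<^sub>R X \<gamma> \<omega>) y < \<delta>}"
    using y(2) \<delta>(1) \<eta> by (intro ld_lower_bound_ball) auto
  with eventually_gt_at_top[of 0] show ?thesis
  proof eventually_elim
    case (elim \<gamma>)
    have [measurable]: "X \<gamma> \<in> borel_measurable M" "E \<in> sets borel" using elim E by (auto intro: measurable_X)
    have "exp (- \<gamma> * (I a + \<eta>)) \<le> exp (- \<gamma> * (I y + \<eta> / 2))"
      using y(3) elim by simp
    also have "\<dots> \<le> prob {\<omega> \<in> space M. dist ((1 / \<gamma>) *\<^sub>R X \<gamma> \<omega>) y < \<delta>}" using elim by simp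
    also have "\<dots> \<le> target_prob M X E \<gamma>"
      unfolding target_prob_def using \<delta>(2)
      by (intro finite_measure_mono) (auto simp: dist_commute subset_eq)
    finally show ?case .
  qed
qed

end

section \<open>A criterion for strong probabilistic efficiency\<close>

text \<open>A part \<open>Z1\<close> that is bounded by a subexponential multiple of \<open>p\<close> needs a subexponential number
  of replications only, and a part \<open>Z2\<close> of negligible mean is harmless for every number of them. The
  sample size is \<open>\<gamma> * C \<gamma> / p \<gamma>\<close>, rounded: the factor \<open>\<gamma>\<close> sends the bound from Chebyshev's
  inequality to \<open>0\<close> without changing the exponential order, and the exponential decay of \<open>p\<close> turns
  \<open>ln n = o(\<gamma>)\<close> into the subexponential condition.\<close>

lemma strongly_prob_efficientI:
  fixes Q :: "real \<Rightarrow> 'w measure" and Z Z1 Z2 :: "real \<Rightarrow> 'w \<Rightarrow> real" and C p :: "real \<Rightarrow> real"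
  assumes Q: "\<forall>\<^sub>F \<gamma> in at_top. prob_space (Q \<gamma>)"
    and split: "\<forall>\<^sub>F \<gamma> in at_top. AE \<omega> in Q \<gamma>. Z \<gamma> \<omega> = Z1 \<gamma> \<omega> + Z2 \<gamma> \<omega>"
    and Z1: "\<forall>\<^sub>F \<gamma> in at_top. Z1 \<gamma> \<in> borel_measurable (Q \<gamma>) \<and> (\<forall>\<omega>. 0 \<le> Z1 \<gamma> \<omega> \<and> Z1 \<gamma> \<omega> \<le> C \<gamma>)"
    and Z2: "\<forall>\<^sub>F \<gamma> in at_top. integrable (Q \<gamma>) (Z2 \<gamma>) \<and> (\<forall>\<omega>. 0 \<le> Z2 \<gamma> \<omega>)"
    and mean: "\<forall>\<^sub>F \<gamma> in at_top. p \<gamma> = (\<integral>\<omega>. Z1 \<gamma> \<omega> \<partial>Q \<gamma>) + (\<integral>\<omega>. Z2 \<gamma> \<omega> \<partial>Q \<gamma>)"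
    and pos: "\<forall>\<^sub>F \<gamma> in at_top. p \<gamma> > 0"
    and negl: "((\<lambda>\<gamma>. (\<integral>\<omega>. Z2 \<gamma> \<omega> \<partial>Q \<gamma>) / p \<gamma>) \<longlongrightarrow> 0) at_top"
    and subexp: "\<And>\<eta>. \<eta> > 0 \<Longrightarrow> \<forall>\<^sub>F \<gamma> in at_top. C \<gamma> \<le> exp (\<eta> * \<gamma>) * p \<gamma>"
    and decay: "c > 0" "\<forall>\<^sub>F \<gamma> in at_top. p \<gamma> \<le> exp (- c * \<gamma>)"
  shows "strongly_prob_efficient Q Z p"
proof -
  define n where "n \<gamma> = max 1 (nat \<lceil>\<gamma> * C \<gamma> / p \<gamma>\<rceil>)" for \<gamma>
  have n1: "n \<gamma> \<ge> 1" for \<gamma> by (simp add: n_def)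
  have n_ge: "\<gamma> * C \<gamma> / p \<gamma> \<le> real (n \<gamma>)" for \<gamma>
    unfolding n_def by (simp add: of_nat_max le_max_iff_disj real_nat_ceiling_ge)
  have C: "\<forall>\<^sub>F \<gamma> in at_top. C \<gamma> \<ge> 0"
    using Z1 by eventually_elim (meson order_trans)
  have n_le: "\<forall>\<^sub>F \<gamma> in at_top. real (n \<gamma>) \<le> \<gamma> * C \<gamma> / p \<gamma> + 1"
    using C pos eventually_gt_at_top[of 0]
  proof eventually_elim
    case (elim \<gamma>)
    then have "0 \<le> \<gamma> * C \<gamma> / p \<gamma>" by simp
    then show ?case unfolding n_def by (simp add: of_nat_max)
  qed
  have ln_n: "\<forall>\<^sub>F \<gamma> in at_top. ln (real (n \<gamma>)) \<le> 2 * \<eta> * \<gamma>" if \<eta>: "\<eta> > 0" for \<eta>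
    (* Beyond 2 / eta^2 the quadratic term of exp (eta * gamma) absorbs the factor gamma of the sample size. *)
    using n_le subexp[OF \<eta>] pos eventually_gt_at_top[of 0] eventually_ge_at_top[of "2 / \<eta>\<^sup>2"]
  proof eventually_elim
    case (elim \<gamma>)
    have "\<gamma> * C \<gamma> / p \<gamma> \<le> \<gamma> * exp (\<eta> * \<gamma>)" using elim by (simp add: field_simps)
    moreover have "1 \<le> exp (\<eta> * \<gamma>)" using \<eta> elim unfolding one_le_exp_iff by (intro mult_nonneg_nonneg) auto
    ultimately have "real (n \<gamma>) \<le> (1 + \<gamma>) * exp (\<eta> * \<gamma>)" using elim(1) unfolding distrib_right by linarith
    also have "1 + \<gamma> \<le> exp (\<eta> * \<gamma>)"
    proof -
      have "\<gamma> * 2 \<le> \<gamma> * (\<eta>\<^sup>2 * \<gamma>)"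
        using elim \<eta> by (intro mult_left_mono) (auto simp: field_simps)
      then have "\<gamma> \<le> (\<eta> * \<gamma>)\<^sup>2 / 2" by (simp add: power2_eq_square algebra_simps)
      then show ?thesis using exp_lower_Taylor_quadratic[of "\<eta> * \<gamma>"] elim \<eta>
        by (smt (verit) mult_nonneg_nonneg)
    qed
    finally have "real (n \<gamma>) \<le> exp (2 * \<eta> * \<gamma>)"
      by (simp add: exp_add[symmetric] mult_right_mono mult.assoc)
    then have "ln (real (n \<gamma>)) \<le> ln (exp (2 * \<eta> * \<gamma>))" using n1[of \<gamma>] by (intro ln_mono) auto
    then show ?case by simp
  qed
  have rate: "((\<lambda>\<gamma>. ereal (ln (real (n \<gamma>))) / - elog (ennreal (p \<gamma>))) \<longlongrightarrow> 0) at_top"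
  proof -
    have "((\<lambda>\<gamma>. ln (real (n \<gamma>)) / - ln (p \<gamma>)) \<longlongrightarrow> 0) at_top"
    proof (rule tendstoI)
      fix e :: real assume e: "e > 0"
      define \<eta> where "\<eta> = e * c / 4"
      have \<eta>: "\<eta> > 0" using e decay by (simp add: \<eta>_def)
      show "\<forall>\<^sub>F \<gamma> in at_top. dist (ln (real (n \<gamma>)) / - ln (p \<gamma>)) 0 < e"
        using ln_n[OF \<eta>] decay(2) pos eventually_gt_at_top[of 0]
      proof eventually_elim
        case (elim \<gamma>)
        have "ln (p \<gamma>) \<le> ln (exp (- c * \<gamma>))" using elim by (subst ln_le_cancel_iff) auto
        then have l: "c * \<gamma> \<le> - ln (p \<gamma>)" by simp
        have cg: "0 < c * \<gamma>" using decay elim by simp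
        have "ln (real (n \<gamma>)) \<le> e / 2 * (c * \<gamma>)" using elim(1) by (simp add: \<eta>_def algebra_simps)
        also have "\<dots> \<le> e / 2 * (- ln (p \<gamma>))" using l e by (intro mult_left_mono) auto
        finally have "ln (real (n \<gamma>)) / - ln (p \<gamma>) \<le> e / 2"
          using l cg by (subst pos_divide_le_eq) auto
        moreover have "0 \<le> ln (real (n \<gamma>)) / - ln (p \<gamma>)"
          using n1[of \<gamma>] l cg by (intro divide_nonneg_pos) auto
        ultimately show ?case using e unfolding dist_real_def by linarith
      qed
    qed
    then have "((\<lambda>\<gamma>. ereal (ln (real (n \<gamma>)) / - ln (p \<gamma>))) \<longlongrightarrow> ereal 0) at_top" by simp
    moreover have "\<forall>\<^sub>F \<gamma> in at_top. ereal (ln (real (n \<gamma>)) / - ln (p \<gamma>))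
        = ereal (ln (real (n \<gamma>))) / - elog (ennreal (p \<gamma>))"
      using pos decay(2) eventually_gt_at_top[of 0]
    proof eventually_elim
      case (elim \<gamma>)
      have "p \<gamma> < 1" using elim decay(1) by (meson exp_less_one_iff le_less_trans minus_mult_minus mult_neg_pos neg_less_0_iff_less)
      then have "ln (p \<gamma>) \<noteq> 0" using elim by simp
      moreover have "elog (ennreal (p \<gamma>)) = ereal (ln (p \<gamma>))" using elim by (simp add: elog_def)
      ultimately show ?case by simp
    qed
    ultimately show ?thesis unfolding zero_ereal_def by (rule Lim_transform_eventually)
  qed
  have acc: "((\<lambda>\<gamma>. accuracy (Q \<gamma>) (Z \<gamma>) (n \<gamma>) (p \<gamma>) \<epsilon>) \<longlongrightarrow> 0) at_top" if \<epsilon>: "\<epsilon> > 0" for \<epsilon>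
  proof (rule order_tendstoI)
    fix b :: ereal assume b: "b < 0"
    have "0 \<le> accuracy (Q \<gamma>) (Z \<gamma>) (n \<gamma>) (p \<gamma>) \<epsilon>" for \<gamma>
      unfolding accuracy_def by (rule INF_greatest) auto
    then show "\<forall>\<^sub>F \<gamma> in at_top. b < accuracy (Q \<gamma>) (Z \<gamma>) (n \<gamma>) (p \<gamma>) \<epsilon>"
      using b by (intro always_eventually allI) (rule less_le_trans)
  next
    fix b :: ereal assume "0 < b"
    then obtain \<delta> where \<delta>: "0 < \<delta>" "ereal \<delta> < b" using ereal_dense2[of 0 b] by auto
    let ?r = "\<lambda>\<gamma>. (\<integral>\<omega>. Z2 \<gamma> \<omega> \<partial>Q \<gamma>) / p \<gamma>"
    have "((\<lambda>\<gamma>. 4 / \<delta>\<^sup>2 * inverse \<gamma> + 4 / \<delta> * ?r \<gamma>) \<longlongrightarrow> 4 / \<delta>\<^sup>2 * 0 + 4 / \<delta> * 0) at_top"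
      by (intro tendsto_add tendsto_mult tendsto_const negl tendsto_inverse_0_at_top filterlim_ident)
    then have "\<forall>\<^sub>F \<gamma> in at_top. 4 / \<delta>\<^sup>2 * inverse \<gamma> + 4 / \<delta> * ?r \<gamma> < \<epsilon>"
      by (rule order_tendstoD(2)) (use \<epsilon> in simp)
    with Q split Z1 Z2 mean pos C eventually_gt_at_top[of 0]
    show "\<forall>\<^sub>F \<gamma> in at_top. accuracy (Q \<gamma>) (Z \<gamma>) (n \<gamma>) (p \<gamma>) \<epsilon> < b"
    proof eventually_elim
      case (elim \<gamma>)
      have "C \<gamma> / (real (n \<gamma>) * p \<gamma>) \<le> inverse \<gamma>"
      proof -
        have "0 < p \<gamma>" "0 < \<gamma>" "0 < real (n \<gamma>)" using n1[of \<gamma>] elim by auto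
        then show ?thesis using n_ge[of \<gamma>] by (simp add: divide_le_eq inverse_eq_divide le_divide_eq mult.commute)
      qed
      then have "4 / \<delta>\<^sup>2 * (C \<gamma> / (real (n \<gamma>) * p \<gamma>)) \<le> 4 / \<delta>\<^sup>2 * inverse \<gamma>"
        by (intro mult_left_mono) auto
      then have le: "4 / \<delta>\<^sup>2 * (C \<gamma> / (real (n \<gamma>) * p \<gamma>)) + 4 / \<delta> * ?r \<gamma> \<le> \<epsilon>"
        using elim by linarith
      have "emeasure (PiM {..<n \<gamma>} (\<lambda>_. Q \<gamma>))
          {w \<in> space (PiM {..<n \<gamma>} (\<lambda>_. Q \<gamma>)). \<bar>sample_mean (Z \<gamma>) (n \<gamma>) w - p \<gamma>\<bar> > \<delta> * p \<gamma>}
        \<le> ennreal (4 / \<delta>\<^sup>2 * (C \<gamma> / (real (n \<gamma>) * p \<gamma>)) + 4 / \<delta> * ?r \<gamma>)"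
        using n1[of \<gamma>] elim \<delta>(1)
        by (intro emeasure_sample_mean_error[where ?Z1.0 = "Z1 \<gamma>"]) auto
      also have "\<dots> \<le> ennreal \<epsilon>" by (rule ennreal_leI[OF le])
      finally have "accuracy (Q \<gamma>) (Z \<gamma>) (n \<gamma>) (p \<gamma>) \<epsilon> \<le> ereal \<delta>"
        unfolding accuracy_def using \<delta>(1) by (intro INF_lower) auto
      then show ?case using \<delta>(2) by (rule le_less_trans)
    qed
  qed
  show ?thesis
    unfolding strongly_prob_efficient_def using n1 rate acc by (intro exI[of _ n]) auto
qed

section \<open>Reciprocals of positive densities\<close>

context
  fixes M :: "'w measure" and f :: "'w \<Rightarrow> real"
  assumes f[measurable]: "f \<in> borel_measurable M" and f_pos: "\<And>\<omega>. f \<omega> > 0"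
begin

lemma density_reciprocal: "density (density M (\<lambda>\<omega>. ennreal (f \<omega>))) (\<lambda>\<omega>. ennreal (1 / f \<omega>)) = M"
proof -
  have "ennreal (f \<omega>) * ennreal (1 / f \<omega>) = 1" for \<omega>
    using f_pos[of \<omega>] by (simp add: ennreal_mult[symmetric] less_imp_le)
  then show ?thesis by (subst density_density_eq) (simp_all add: density_1)
qed

lemma AE_RN_deriv_reciprocal:
  assumes "sigma_finite_measure (density M (\<lambda>\<omega>. ennreal (f \<omega>)))"
  shows "AE \<omega> in density M (\<lambda>\<omega>. ennreal (f \<omega>)).
    RN_deriv (density M (\<lambda>\<omega>. ennreal (f \<omega>))) M \<omega> = ennreal (1 / f \<omega>)"
proof -
  have "AE \<omega> in density M (\<lambda>\<omega>. ennreal (f \<omega>)).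
      ennreal (1 / f \<omega>) = RN_deriv (density M (\<lambda>\<omega>. ennreal (f \<omega>))) M \<omega>"
    by (rule sigma_finite_measure.RN_deriv_unique[OF assms _ density_reciprocal]) simp
  then show ?thesis by eventually_elim simp
qed

lemma
  assumes B: "B \<in> sets M" "emeasure M B < \<infinity>"
  shows integrable_indicator_reciprocal:
      "integrable (density M (\<lambda>\<omega>. ennreal (f \<omega>))) (\<lambda>\<omega>. indicator B \<omega> / f \<omega>)"
    and integral_indicator_reciprocal:
      "(\<integral>\<omega>. indicator B \<omega> / f \<omega> \<partial>density M (\<lambda>\<omega>. ennreal (f \<omega>))) = measure M B"
proof -
  have eq: "f \<omega> *\<^sub>R (indicator B \<omega> / f \<omega>) = indicator B \<omega>" for \<omega>
    using f_pos[of \<omega>] by simp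
  note [measurable] = B(1)
  show "integrable (density M (\<lambda>\<omega>. ennreal (f \<omega>))) (\<lambda>\<omega>. indicator B \<omega> / f \<omega>)"
    using B f_pos by (subst integrable_density) (auto simp: eq less_imp_le simp del: real_scaleR_def)
  show "(\<integral>\<omega>. indicator B \<omega> / f \<omega> \<partial>density M (\<lambda>\<omega>. ennreal (f \<omega>))) = measure M B"
    using B f_pos by (subst integral_density) (auto simp: eq less_imp_le simp del: real_scaleR_def)
qed

end

section \<open>Mixtures of exponential tiltings\<close>

context ld_family
begin

definition mixture_density :: "nat \<Rightarrow> (nat \<Rightarrow> real) \<Rightarrow> (nat \<Rightarrow> 'a) \<Rightarrow> real \<Rightarrow> 'w \<Rightarrow> real" where
  "mixture_density k \<alpha> s \<gamma> \<omega> = (\<Sum>i=1..k. \<alpha> i * exp (s i \<bullet> X \<gamma> \<omega> - \<gamma> * \<kappa> \<gamma> (s i)))"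

lemma tilted_mixture_eq:
  "tilted_mixture M X k \<alpha> s \<gamma> = density M (\<lambda>\<omega>. ennreal (mixture_density k \<alpha> s \<gamma> \<omega>))"
  by (simp add: tilted_mixture_def mixture_density_def \<kappa>_def)

lemma measurable_mixture_density:
  "\<gamma> > 0 \<Longrightarrow> mixture_density k \<alpha> s \<gamma> \<in> borel_measurable M"
  using measurable_X[of \<gamma>] unfolding mixture_density_def[abs_def] by measurable

lemma mixture_density_pos:
  assumes "\<And>i. i \<in> {1..k} \<Longrightarrow> \<alpha> i > 0" "(\<Sum>i=1..k. \<alpha> i) = 1"
  shows "mixture_density k \<alpha> s \<gamma> \<omega> > 0"
  proof -
  have "k \<noteq> 0" using assms(2) by (cases k) auto
  then show ?thesis unfolding mixture_density_def using assms(1) by (intro sum_pos) auto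
qed

lemma prob_space_tilted_mixture:
  assumes g: "\<gamma> > 0" and fin: "\<And>i. i \<in> {1..k} \<Longrightarrow> scaled_cgf M X \<gamma> (s i) < \<infinity>"
    and \<alpha>: "\<And>i. i \<in> {1..k} \<Longrightarrow> \<alpha> i > 0" "(\<Sum>i=1..k. \<alpha> i) = 1"
  shows "prob_space (tilted_mixture M X k \<alpha> s \<gamma>)"
proof (rule prob_spaceI)
  have [measurable]: "X \<gamma> \<in> borel_measurable M" by (rule measurable_X[OF g])
  have one: "(\<integral>\<^sup>+ \<omega>. ennreal (exp (s i \<bullet> X \<gamma> \<omega> - \<gamma> * \<kappa> \<gamma> (s i))) \<partial>M) = 1" if "i \<in> {1..k}" for i
  proof -
    have "emeasure (tilt \<gamma> (s i)) (space (tilt \<gamma> (s i))) = 1"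
      using prob_space_tilt[OF g fin[OF that]] by (rule prob_space.emeasure_space_1)
    then show ?thesis by (simp add: tilt_def emeasure_density cong: nn_integral_cong)
  qed
  have "emeasure (tilted_mixture M X k \<alpha> s \<gamma>) (space (tilted_mixture M X k \<alpha> s \<gamma>))
      = (\<integral>\<^sup>+ \<omega>. ennreal (mixture_density k \<alpha> s \<gamma> \<omega>) \<partial>M)"
    using measurable_mixture_density[OF g] unfolding tilted_mixture_eq
    by (simp add: emeasure_density cong: nn_integral_cong)
  also have "\<dots> = (\<integral>\<^sup>+ \<omega>. (\<Sum>i=1..k. ennreal (\<alpha> i) * ennreal (exp (s i \<bullet> X \<gamma> \<omega> - \<gamma> * \<kappa> \<gamma> (s i)))) \<partial>M)"
  proof (rule nn_integral_cong)
    fix \<omega>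
    have "(\<Sum>i=1..k. ennreal (\<alpha> i) * ennreal (exp (s i \<bullet> X \<gamma> \<omega> - \<gamma> * \<kappa> \<gamma> (s i))))
        = (\<Sum>i=1..k. ennreal (\<alpha> i * exp (s i \<bullet> X \<gamma> \<omega> - \<gamma> * \<kappa> \<gamma> (s i))))"
      using \<alpha>(1) by (intro sum.cong) (auto simp: ennreal_mult less_imp_le)
    also have "\<dots> = ennreal (mixture_density k \<alpha> s \<gamma> \<omega>)"
      unfolding mixture_density_def using \<alpha>(1) by (intro sum_ennreal) (auto simp: less_imp_le)
    finally show "ennreal (mixture_density k \<alpha> s \<gamma> \<omega>)
        = (\<Sum>i=1..k. ennreal (\<alpha> i) * ennreal (exp (s i \<bullet> X \<gamma> \<omega> - \<gamma> * \<kappa> \<gamma> (s i))))" by simp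
  qed
  also have "\<dots> = (\<Sum>i=1..k. ennreal (\<alpha> i) * (\<integral>\<^sup>+ \<omega>. ennreal (exp (s i \<bullet> X \<gamma> \<omega> - \<gamma> * \<kappa> \<gamma> (s i))) \<partial>M))"
    by (subst nn_integral_sum) (auto simp: nn_integral_cmult)
  also have "\<dots> = (\<Sum>i=1..k. ennreal (\<alpha> i))" using one by simp
  also have "\<dots> = 1" using \<alpha> by (subst sum_ennreal) (auto simp: less_imp_le)
  finally show "emeasure (tilted_mixture M X k \<alpha> s \<gamma>) (space (tilted_mixture M X k \<alpha> s \<gamma>)) = 1" .
qed

text \<open>On the half-space of one of the mixed points the weight can be bounded by dropping all other
  components of the mixture.\<close>

lemma reciprocal_mixture_density_le:
  assumes \<alpha>: "\<And>i. i \<in> {1..k} \<Longrightarrow> \<alpha> i > 0" and g: "\<gamma> > 0"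
    and j: "j \<in> {1..k}" "s j \<bullet> ((1 / \<gamma>) *\<^sub>R X \<gamma> \<omega> - b) \<ge> 0"
  shows "1 / mixture_density k \<alpha> s \<gamma> \<omega> \<le> 1 / \<alpha> j * exp (- \<gamma> * (s j \<bullet> b - \<kappa> \<gamma> (s j)))"
proof -
  have "\<gamma> * (s j \<bullet> b) \<le> \<gamma> * (s j \<bullet> ((1 / \<gamma>) *\<^sub>R X \<gamma> \<omega>))"
    using j(2) g by (intro mult_left_mono) (auto simp: inner_diff_right)
  then have le: "\<gamma> * (s j \<bullet> b) \<le> s j \<bullet> X \<gamma> \<omega>" using g by simp
  have aj: "\<alpha> j > 0" using \<alpha> j by simp
  have "\<alpha> j * exp (\<gamma> * (s j \<bullet> b - \<kappa> \<gamma> (s j))) \<le> \<alpha> j * exp (s j \<bullet> X \<gamma> \<omega> - \<gamma> * \<kappa> \<gamma> (s j))"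
    using le aj by (simp add: right_diff_distrib)
  also have "\<dots> \<le> mixture_density k \<alpha> s \<gamma> \<omega>"
    unfolding mixture_density_def using \<alpha> j(1)
    by (intro member_le_sum[where f = "\<lambda>i. \<alpha> i * exp (s i \<bullet> X \<gamma> \<omega> - \<gamma> * \<kappa> \<gamma> (s i))"])
       (auto simp: less_imp_le)
  finally have "1 / mixture_density k \<alpha> s \<gamma> \<omega> \<le> 1 / (\<alpha> j * exp (\<gamma> * (s j \<bullet> b - \<kappa> \<gamma> (s j))))"
    using aj by (intro frac_le) auto
  also have "\<dots> = 1 / \<alpha> j * exp (- \<gamma> * (s j \<bullet> b - \<kappa> \<gamma> (s j)))"
    unfolding mult_minus_left exp_minus by (simp add: divide_inverse)
  finally show ?thesis .
qed

end

section \<open>Efficiency of the mixture\<close>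

theorem theorem6:
  fixes M :: "'w measure"
    and X :: "real \<Rightarrow> 'w \<Rightarrow> 'a::euclidean_space"
    and \<mu> :: "'a \<Rightarrow> ereal"
    and E A :: "'a set"
    and k :: nat
    and a :: "nat \<Rightarrow> 'a"
    and \<alpha> :: "nat \<Rightarrow> real"
  assumes "prob_space M"
    and "\<And>\<gamma>. \<gamma> > 0 \<Longrightarrow> X \<gamma> \<in> borel_measurable M"
    and "assumption_A M X \<mu>"
    and "assumption_B \<mu> E"
    and "dominating_set \<mu> E A"
    and "inj_on a {1..k}" and "a ` {1..k} \<subseteq> A"
    and "\<And>i j. i \<in> {1..k} \<Longrightarrow> j \<in> {1..k} \<Longrightarrow> rate \<mu> (a i) = rate \<mu> (a j)"
    and "\<And>i a'. i \<in> {1..k} \<Longrightarrow> a' \<in> A - a ` {1..k} \<Longrightarrow> rate \<mu> (a i) < rate \<mu> a'"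
    and "\<And>i. i \<in> {1..k} \<Longrightarrow> \<alpha> i > 0"
    and "(\<Sum>i=1..k. \<alpha> i) = 1"
  defines "Q \<equiv> tilted_mixture M X k \<alpha> (\<lambda>i. tilt_param \<mu> (a i))"
  shows "strongly_prob_efficient Q (\<lambda>\<gamma>. is_estimator M (Q \<gamma>) X E \<gamma>) (target_prob M X E)"
proof -
  interpret ld_family M X \<mu> using assms(1-3) by (simp add: ld_family_def ld_family_axioms_def)
  note \<alpha> = assms(10,11)
  define s where "s = tilt_param \<mu>"
  have k: "1 \<in> {1..k}" using \<alpha>(2) by (cases k) auto
  have finA: "finite A" and frA: "A \<subseteq> frontier E" and cover: "E \<subseteq> (\<Union>b\<in>A. {x. s b \<bullet> (x - b) \<ge> 0})"
    and ADI: "\<And>b. b \<in> A \<Longrightarrow> b \<in> DI" and uniq: "\<And>b. b \<in> A \<Longrightarrow> \<exists>!s. has_gradient \<mu> s b"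
    using assms(5) by (auto simp: dominating_set_def halfspaces_cover_def s_def)
  have grad: "has_gradient \<mu> (s b) b" if "b \<in> A" for b
    unfolding s_def tilt_param_def using uniq[OF that] by (rule theI')
  have aA: "a i \<in> A" if "i \<in> {1..k}" for i using assms(7) that by blast
  have DIA: "b \<in> eff_dom (rate \<mu>)" if "b \<in> A" for b using ADI[OF that] interior_subset by blast
  have sdom: "s b \<in> eff_dom \<mu>" if "b \<in> A" for b
    using has_gradientD(1)[OF grad[OF that]] interior_subset by blast
  have E: "E \<in> sets borel" "closure E = closure (interior E)" "rate_set \<mu> E > 0"
    using assms(4) by (auto simp: assumption_B_def)
  have Acl: "b \<in> closure E" if "b \<in> A" for b using frA that by (auto simp: frontier_def)
  define I0 where "I0 = I (a 1)"
  have Ia: "I (a i) = I0" if "i \<in> {1..k}" for i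
    unfolding I0_def I_def using assms(8)[OF that k] by simp
  have Ib: "I0 < I b" if "b \<in> A - a ` {1..k}" for b
    using assms(9)[OF k that] that aA[OF k] by (simp add: rate_eq_I DIA I0_def)
  have I_ge: "I0 \<le> I b" if "b \<in> A" for b
    using Ia Ib[of b] that by (cases "b \<in> a ` {1..k}") auto
  have I0: "I0 > 0"
    unfolding I0_def using ADI[OF aA[OF k]] Acl[OF aA[OF k]] E(3) by (rule I_pos)
  let ?p = "target_prob M X E"
  define H where "H b = {x. s b \<bullet> (x - b) \<ge> 0}" for b
  have H[measurable]: "H b \<in> sets borel" for b
    unfolding H_def by (auto simp: inner_diff_right closed_halfspace_ge intro!: borel_closed)
  note [measurable] = E(1)
  have lower: "\<forall>\<^sub>F \<gamma> in at_top. exp (- \<gamma> * (I0 + \<eta>)) \<le> ?p \<gamma>" if "\<eta> > 0" for \<eta>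
    unfolding I0_def using ADI[OF aA[OF k]] Acl[OF aA[OF k]] E(1,2) that by (intro ld_lower_bound) auto
  have upper: "\<forall>\<^sub>F \<gamma> in at_top. prob {\<omega> \<in> space M. (1 / \<gamma>) *\<^sub>R X \<gamma> \<omega> \<in> H b} \<le> exp (- \<gamma> * (I b - \<eta>))"
    if "b \<in> A" "\<eta> > 0" for b \<eta>
    using chernoff[OF grad[OF that(1)] that(2)] by (simp add: H_def)
  have pos: "\<forall>\<^sub>F \<gamma> in at_top. ?p \<gamma> > 0"
    using lower[of 1] by (auto elim!: eventually_mono intro: less_le_trans[OF exp_gt_zero])
  (* On E1 the weights are bounded; E2 is reached only through half-spaces of strictly larger rate. *)
  define E1 where "E1 = E \<inter> (\<Union>i\<in>{1..k}. H (a i))"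
  define E2 where "E2 = E - E1"
  have [measurable]: "E1 \<in> sets borel" "E2 \<in> sets borel"
    unfolding E1_def E2_def by measurable
  have E2H: "E2 \<subseteq> (\<Union>b\<in>A - a ` {1..k}. H b)"
    using cover unfolding E2_def E1_def H_def by blast
  let ?f = "mixture_density k \<alpha> (\<lambda>i. s (a i))"
  let ?ev = "\<lambda>S \<gamma>. {\<omega> \<in> space M. (1 / \<gamma>) *\<^sub>R X \<gamma> \<omega> \<in> S}"
  have Q_eq: "Q \<gamma> = density M (\<lambda>\<omega>. ennreal (?f \<gamma> \<omega>))" for \<gamma>
    unfolding Q_def tilted_mixture_eq s_def ..
  have f_pos: "?f \<gamma> \<omega> > 0" for \<gamma> \<omega> using \<alpha> by (rule mixture_density_pos)
  have ev: "?ev S \<gamma> \<in> sets M" if "\<gamma> > 0" "S \<in> sets borel" for S \<gamma>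
  proof -
    have [measurable]: "X \<gamma> \<in> borel_measurable M" "S \<in> sets borel" using that by (auto intro: measurable_X)
    show ?thesis by measurable
  qed
  define Z1 where "Z1 \<gamma> \<omega> = indicator (?ev E1 \<gamma>) \<omega> / ?f \<gamma> \<omega>" for \<gamma> \<omega>
  define Z2 where "Z2 \<gamma> \<omega> = indicator (?ev E2 \<gamma>) \<omega> / ?f \<gamma> \<omega>" for \<gamma> \<omega>
  define C where "C \<gamma> = (\<Sum>i=1..k. 1 / \<alpha> i * exp (- \<gamma> * (s (a i) \<bullet> a i - \<kappa> \<gamma> (s (a i)))))" for \<gamma>
  have "\<forall>\<^sub>F \<gamma> in at_top. \<forall>i\<in>{1..k}. \<gamma> > 0 \<and> scaled_cgf M X \<gamma> (s (a i)) < \<infinity>"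
    using aA by (intro eventually_ball_finite ballI eventually_scaled_cgf_finite sdom) auto
  then have Qprob: "\<forall>\<^sub>F \<gamma> in at_top. prob_space (Q \<gamma>)"
  proof eventually_elim
    case (elim \<gamma>)
    then show ?case using k \<alpha> unfolding Q_def s_def[symmetric] by (intro prob_space_tilted_mixture) auto
  qed
  have EZ: "integrable (Q \<gamma>) (Z1 \<gamma>)" "integrable (Q \<gamma>) (Z2 \<gamma>)"
    "(\<integral>\<omega>. Z1 \<gamma> \<omega> \<partial>Q \<gamma>) = prob (?ev E1 \<gamma>)" "(\<integral>\<omega>. Z2 \<gamma> \<omega> \<partial>Q \<gamma>) = prob (?ev E2 \<gamma>)"
    if g: "\<gamma> > 0" for \<gamma>
    unfolding Z1_def Z2_def Q_eq
    by (intro integrable_indicator_reciprocal integral_indicator_reciprocal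
          measurable_mixture_density f_pos ev g; simp add: emeasure_eq_measure)+
  show ?thesis
  proof (rule strongly_prob_efficientI[where ?Z1.0 = Z1 and ?Z2.0 = Z2 and C = C and c = "I0 / 2"])
    show "\<forall>\<^sub>F \<gamma> in at_top. prob_space (Q \<gamma>)" by fact
    show "\<forall>\<^sub>F \<gamma> in at_top. AE \<omega> in Q \<gamma>. is_estimator M (Q \<gamma>) X E \<gamma> \<omega> = Z1 \<gamma> \<omega> + Z2 \<gamma> \<omega>"
      using Qprob eventually_gt_at_top[of 0]
    proof eventually_elim
      case (elim \<gamma>)
      interpret Q: prob_space "Q \<gamma>" using elim by simp
      have "AE \<omega> in Q \<gamma>. RN_deriv (Q \<gamma>) M \<omega> = ennreal (1 / ?f \<gamma> \<omega>)"
        using elim Q.sigma_finite_measure unfolding Q_eq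
        by (intro AE_RN_deriv_reciprocal measurable_mixture_density f_pos) auto
      then show ?case
      proof (rule AE_mp, intro AE_I2 impI)
        fix \<omega> assume \<omega>: "\<omega> \<in> space (Q \<gamma>)" "RN_deriv (Q \<gamma>) M \<omega> = ennreal (1 / ?f \<gamma> \<omega>)"
        have "\<omega> \<in> space M" using \<omega>(1) by (simp add: Q_eq)
        then show "is_estimator M (Q \<gamma>) X E \<gamma> \<omega> = Z1 \<gamma> \<omega> + Z2 \<gamma> \<omega>"
          using \<omega>(2) f_pos[of \<gamma> \<omega>]
          by (auto simp: is_estimator_def Z1_def Z2_def E2_def E1_def less_imp_le split: split_indicator)
      qed
    qed
    show "\<forall>\<^sub>F \<gamma> in at_top. Z1 \<gamma> \<in> borel_measurable (Q \<gamma>) \<and> (\<forall>\<omega>. 0 \<le> Z1 \<gamma> \<omega> \<and> Z1 \<gamma> \<omega> \<le> C \<gamma>)"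
      using eventually_gt_at_top[of 0]
    proof eventually_elim
      case (elim \<gamma>)
      have nn: "0 \<le> 1 / \<alpha> i * exp (- \<gamma> * (s (a i) \<bullet> a i - \<kappa> \<gamma> (s (a i))))" if "i \<in> {1..k}" for i
        using \<alpha>(1)[OF that] by simp
      have "Z1 \<gamma> \<omega> \<le> C \<gamma>" for \<omega>
      proof (cases "\<omega> \<in> ?ev E1 \<gamma>")
        case True
        then obtain j where j: "j \<in> {1..k}" "s (a j) \<bullet> ((1 / \<gamma>) *\<^sub>R X \<gamma> \<omega> - a j) \<ge> 0"
          by (auto simp: E1_def H_def)
        have "Z1 \<gamma> \<omega> = 1 / ?f \<gamma> \<omega>" using True by (simp add: Z1_def)
        also have "\<dots> \<le> 1 / \<alpha> j * exp (- \<gamma> * (s (a j) \<bullet> a j - \<kappa> \<gamma> (s (a j))))"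
          using elim \<alpha>(1) j by (intro reciprocal_mixture_density_le) auto
        also have "\<dots> \<le> C \<gamma>"
          unfolding C_def using nn j(1)
          by (intro member_le_sum[where f = "\<lambda>i. 1 / \<alpha> i * exp (- \<gamma> * (s (a i) \<bullet> a i - \<kappa> \<gamma> (s (a i))))"]) auto
        finally show ?thesis .
      next
        case False
        then have "Z1 \<gamma> \<omega> = 0" by (simp add: Z1_def)
        also have "0 \<le> C \<gamma>" unfolding C_def using nn by (intro sum_nonneg) auto
        finally show ?thesis .
      qed
      moreover have "0 \<le> Z1 \<gamma> \<omega>" for \<omega> unfolding Z1_def using f_pos[of \<gamma> \<omega>] by (simp add: less_imp_le)
      ultimately show ?case using EZ(1)[OF elim] by auto
    qed
    show "\<forall>\<^sub>F \<gamma> in at_top. integrable (Q \<gamma>) (Z2 \<gamma>) \<and> (\<forall>\<omega>. 0 \<le> Z2 \<gamma> \<omega>)"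
      using eventually_gt_at_top[of 0]
    proof eventually_elim
      case (elim \<gamma>)
      have "0 \<le> Z2 \<gamma> \<omega>" for \<omega> unfolding Z2_def using f_pos[of \<gamma> \<omega>] by (simp add: less_imp_le)
      then show ?case using EZ(2)[OF elim] by auto
    qed
    show "\<forall>\<^sub>F \<gamma> in at_top. ?p \<gamma> = (\<integral>\<omega>. Z1 \<gamma> \<omega> \<partial>Q \<gamma>) + (\<integral>\<omega>. Z2 \<gamma> \<omega> \<partial>Q \<gamma>)"
      using eventually_gt_at_top[of 0]
    proof eventually_elim
      case (elim \<gamma>)
      have "?ev E \<gamma> = ?ev E1 \<gamma> \<union> ?ev E2 \<gamma>" by (auto simp: E2_def E1_def)
      moreover have "?ev E1 \<gamma> \<inter> ?ev E2 \<gamma> = {}" by (auto simp: E2_def)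
      ultimately show ?case
        unfolding EZ(3,4)[OF elim] target_prob_def
        using elim by (simp add: ev finite_measure_Union)
    qed
    show "\<forall>\<^sub>F \<gamma> in at_top. ?p \<gamma> > 0" by fact
    show "((\<lambda>\<gamma>. (\<integral>\<omega>. Z2 \<gamma> \<omega> \<partial>Q \<gamma>) / ?p \<gamma>) \<longlongrightarrow> 0) at_top"
    proof (rule tendsto_sandwich)
      show "\<forall>\<^sub>F \<gamma> in at_top. 0 \<le> (\<integral>\<omega>. Z2 \<gamma> \<omega> \<partial>Q \<gamma>) / ?p \<gamma>"
        using eventually_gt_at_top[of 0] pos by eventually_elim (simp add: EZ(4))
      show "\<forall>\<^sub>F \<gamma> in at_top. (\<integral>\<omega>. Z2 \<gamma> \<omega> \<partial>Q \<gamma>) / ?p \<gamma>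
          \<le> (\<Sum>b\<in>A - a ` {1..k}. prob (?ev (H b) \<gamma>) / ?p \<gamma>)"
        using eventually_gt_at_top[of 0] pos
      proof eventually_elim
        case (elim \<gamma>)
        have "prob (?ev E2 \<gamma>) \<le> prob (\<Union>b\<in>A - a ` {1..k}. ?ev (H b) \<gamma>)"
          using E2H elim finA by (intro finite_measure_mono sets.finite_UN ev) auto
        also have "\<dots> \<le> (\<Sum>b\<in>A - a ` {1..k}. prob (?ev (H b) \<gamma>))"
          using elim finA by (intro finite_measure_subadditive_finite) (auto simp: ev)
        finally show ?case
          unfolding EZ(4)[OF elim(1)] sum_divide_distrib[symmetric]
          using elim by (intro divide_right_mono) auto
      qed
      show "((\<lambda>\<gamma>. \<Sum>b\<in>A - a ` {1..k}. prob (?ev (H b) \<gamma>) / ?p \<gamma>) \<longlongrightarrow> 0) at_top"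
      proof (rule tendsto_null_sum)
        fix b assume b: "b \<in> A - a ` {1..k}"
        (* Of the gap 3 * eta between the rates, one eta is lost in each of the two large deviation bounds. *)
        define \<eta> where "\<eta> = (I b - I0) / 3"
        have \<eta>: "\<eta> > 0" using Ib[OF b] by (simp add: \<eta>_def)
        show "((\<lambda>\<gamma>. prob (?ev (H b) \<gamma>) / ?p \<gamma>) \<longlongrightarrow> 0) at_top"
        proof (rule tendsto_sandwich)
          show "\<forall>\<^sub>F \<gamma> in at_top. 0 \<le> prob (?ev (H b) \<gamma>) / ?p \<gamma>"
            using pos by eventually_elim simp
          show "\<forall>\<^sub>F \<gamma> in at_top. prob (?ev (H b) \<gamma>) / ?p \<gamma> \<le> exp (\<gamma> * - \<eta>)"
            using pos lower[OF \<eta>] upper[OF DiffD1[OF b] \<eta>]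
          proof eventually_elim
            case (elim \<gamma>)
            have "prob (?ev (H b) \<gamma>) \<le> exp (- \<gamma> * (I b - \<eta>))" using elim b by simp
            also have "\<dots> = exp (\<gamma> * - \<eta>) * exp (- \<gamma> * (I0 + \<eta>))"
              unfolding exp_add[symmetric] \<eta>_def by (simp add: field_simps)
            also have "\<dots> \<le> exp (\<gamma> * - \<eta>) * ?p \<gamma>" using elim by (intro mult_left_mono) auto
            finally show ?case using elim by (subst pos_divide_le_eq) auto
          qed
          show "((\<lambda>\<gamma>. exp (\<gamma> * - \<eta>)) \<longlongrightarrow> 0) at_top"
            by (rule exp_decay_tendsto_0[OF tendsto_const]) (use \<eta> in simp)
        qed simp
      qed
    qed simp
    show "\<forall>\<^sub>F \<gamma> in at_top. C \<gamma> \<le> exp (\<eta> * \<gamma>) * ?p \<gamma>" if \<eta>: "\<eta> > 0" for \<eta>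
    proof -
      have "\<forall>\<^sub>F \<gamma> in at_top. \<forall>i\<in>{1..k}. \<kappa> \<gamma> (s (a i)) < \<mu>\<^sub>r (s (a i)) + \<eta> / 3"
        using \<eta> aA by (intro eventually_ball_finite ballI order_tendstoD(2)[OF tendsto_\<kappa>] sdom) auto
      moreover have "\<forall>\<^sub>F \<gamma> in at_top. exp (\<gamma> * (- \<eta> / 3)) \<le> 1 / (1 + (\<Sum>i=1..k. 1 / \<alpha> i))"
        using \<eta> \<alpha>(1)
        by (intro eventually_exp_decay_le[OF tendsto_const]) (auto intro!: add_pos_nonneg sum_nonneg simp: less_imp_le)
      moreover have "\<forall>\<^sub>F \<gamma> in at_top. exp (- \<gamma> * (I0 + \<eta> / 3)) \<le> ?p \<gamma>"
        using \<eta> by (intro lower) simp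
      ultimately show ?thesis using eventually_gt_at_top[of 0]
      proof eventually_elim
        case (elim \<gamma>)
        let ?S = "\<Sum>i=1..k. 1 / \<alpha> i"
        have S: "?S \<ge> 0" using \<alpha>(1) by (intro sum_nonneg) (auto simp: less_imp_le)
        have "C \<gamma> \<le> (\<Sum>i=1..k. 1 / \<alpha> i * exp (- \<gamma> * (I0 - \<eta> / 3)))"
          unfolding C_def
        proof (intro sum_mono mult_left_mono)
          fix i assume i: "i \<in> {1..k}"
          have "I0 = s (a i) \<bullet> a i - \<mu>\<^sub>r (s (a i))"
            using I_at_gradient(2)[OF grad[OF aA[OF i]]] Ia[OF i] by simp
          then have "\<gamma> * (I0 - \<eta> / 3) \<le> \<gamma> * (s (a i) \<bullet> a i - \<kappa> \<gamma> (s (a i)))"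
            using elim i by (intro mult_left_mono) fastforce+
          then show "exp (- \<gamma> * (s (a i) \<bullet> a i - \<kappa> \<gamma> (s (a i)))) \<le> exp (- \<gamma> * (I0 - \<eta> / 3))"
            by simp
          show "0 \<le> 1 / \<alpha> i" using \<alpha>(1)[OF i] by simp
        qed
        also have "\<dots> = ?S * exp (- \<gamma> * (I0 - \<eta> / 3))" by (rule sum_distrib_right[symmetric])
        also have "\<dots> \<le> exp (\<eta> / 3 * \<gamma>) * exp (- \<gamma> * (I0 - \<eta> / 3))"
        proof (intro mult_right_mono)
          have "exp (\<gamma> * (- \<eta> / 3)) * (1 + ?S) \<le> 1" using elim S by (simp add: pos_le_divide_eq)
          then have "1 + ?S \<le> exp (\<eta> / 3 * \<gamma>)" by (simp add: exp_minus field_simps)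
          then show "?S \<le> exp (\<eta> / 3 * \<gamma>)" by simp
        qed simp
        also have "\<dots> = exp (\<eta> * \<gamma>) * exp (- \<gamma> * (I0 + \<eta> / 3))"
          unfolding exp_add[symmetric] by (simp add: field_simps)
        also have "\<dots> \<le> exp (\<eta> * \<gamma>) * ?p \<gamma>" using elim by (intro mult_left_mono) auto
        finally show ?case .
      qed
    qed
    (* All points of A have rate at least I0. Of the exponent I0, one quarter is lost in Chernoff's bound and one
       quarter absorbs the number of half-spaces. *)
    show "I0 / 2 > 0" using I0 by simp
    have "\<forall>\<^sub>F \<gamma> in at_top. \<forall>b\<in>A. prob (?ev (H b) \<gamma>) \<le> exp (- \<gamma> * (I b - I0 / 4))"
      using finA I0 by (intro eventually_ball_finite ballI upper) auto
    moreover have "\<forall>\<^sub>F \<gamma> in at_top. exp (\<gamma> * (- I0 / 4)) \<le> 1 / card A"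
      using I0 finA aA[OF k] by (intro eventually_exp_decay_le[OF tendsto_const]) (auto simp: card_gt_0_iff)
    ultimately show "\<forall>\<^sub>F \<gamma> in at_top. ?p \<gamma> \<le> exp (- (I0 / 2) * \<gamma>)"
      using eventually_gt_at_top[of 0]
    proof eventually_elim
      case (elim \<gamma>)
      have A0: "card A > 0" using finA aA[OF k] by (auto simp: card_gt_0_iff)
      have "?p \<gamma> \<le> prob (\<Union>b\<in>A. ?ev (H b) \<gamma>)"
        unfolding target_prob_def
        using cover elim finA by (intro finite_measure_mono sets.finite_UN ev) (auto simp: H_def)
      also have "\<dots> \<le> (\<Sum>b\<in>A. prob (?ev (H b) \<gamma>))"
        using elim finA by (intro finite_measure_subadditive_finite) (auto simp: ev)
      also have "\<dots> \<le> (\<Sum>b\<in>A. exp (- \<gamma> * (3 / 4 * I0)))"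
      proof (rule sum_mono)
        fix b assume b: "b \<in> A"
        have "\<gamma> * (3 / 4 * I0) \<le> \<gamma> * (I b - I0 / 4)"
          using I_ge[OF b] elim by (intro mult_left_mono) auto
        then have "exp (- \<gamma> * (I b - I0 / 4)) \<le> exp (- \<gamma> * (3 / 4 * I0))" by simp
        with elim b show "prob (?ev (H b) \<gamma>) \<le> exp (- \<gamma> * (3 / 4 * I0))" by (meson order_trans)
      qed
      also have "\<dots> = (exp (\<gamma> * (- I0 / 4)) * card A) * exp (- (I0 / 2) * \<gamma>)"
      proof -
        have "exp (- \<gamma> * (3 / 4 * I0)) = exp (\<gamma> * (- I0 / 4)) * exp (- (I0 / 2) * \<gamma>)"
          unfolding exp_add[symmetric] by (simp add: field_simps)
        then show ?thesis by simp
      qed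
      also have "\<dots> \<le> 1 * exp (- (I0 / 2) * \<gamma>)"
        using elim A0 by (intro mult_right_mono) (auto simp: pos_le_divide_eq)
      finally show ?case by simp
    qed
  qed
qed

end
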